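(* For all orthogonal projectors $P$ in $\mathcal H$, all linear operators $L$ acting in $\operatorname{Ker}P$ (extended by $0$ to $\mathcal H$), and all $k\in\mathbb C\setminus\{0\}$, the number $-k^2\in\mathbb C\setminus\{0\}$ is an eigenvalue of $A_{P,L}$ if and only if the matrix $$Z_{P,L}(k):=(P+L)X(k)+P^\perp Y(k)$$ has non-trivial null space. The geometric multiplicity of $-k^2$ equals the dimension of $\operatorname{Ker}Z_{P,L}(k)$.
   Context: Setting. $\mathsf E=\mathsf E_d\sqcup\mathsf E_t$ is the finite edge set of a finite metric graph, with diffusion edges identified with intervals $[0,a_{di}]$, $i=1,\dots,D$, and transport edges identified with intervals $[0,a_{tj}]$, $j=1,\dots,T$, all lengths being positive and finite. $L^2(\mathsf E)=L^2(\mathsf E_d)\oplus L^2(\mathsf E_t)$, where $L^2(\mathsf E_d)=\bigoplus_i L^2(0,a_{di})$, $L^2(\mathsf E_t)=\bigoplus_j L^2(0,a_{tj})$ (complex-valued), and $u=(u_d,u_t)$ with components $u_{di},u_{tj}$. $H^m(\mathsf E_d)=\bigoplus_i H^m(0,a_{di})$ and $H^m(\mathsf E_t)=\bigoplus_j H^m(0,a_{tj})$, with no boundary conditions. Boundary space. $\mathcal H=\mathcal H_d^+\oplus\mathcal H_d^-\oplus\mathcal H_t$ with $\mathcal H_d^\pm=\mathbb C^{D}$, $\mathcal H_t=\mathbb C^{T}$. For $u\in H^2(\mathsf E_d)\oplus H^1(\mathsf E_t)$, $$\underline u=\begin{bmatrix}\{u_{di}(a_{di})\}_{i}\\ \{u_{di}(0)\}_{i}\\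 2^{-1/2}\{u_{tj}(a_{tj})+u_{tj}(0)\}_{j}\end{bmatrix},\qquad \underline{\underline u}=\begin{bmatrix}\{u_{di}'(a_{di})\}_{i}\\ \{-u_{di}'(0)\}_{i}\\ 2^{-1/2}\{-u_{tj}(a_{tj})+u_{tj}(0)\}_{j}\end{bmatrix}.$$ Operator. With $P^\perp=\mathrm{Id}-P$, $$D(A_{P,L})=\{u\in H^2(\mathsf E_d)\oplus H^1(\mathsf E_t): P^\perp\underline{\underline u}+(L+P)\underline u=0\},\qquad A_{P,L}(u_d,u_t)=(u_d'',-u_t').$$ Matrices. With respect to the decomposition $\mathcal H=\mathcal H_d^+\oplus\mathcal H_d^-\oplus\mathcal H_t$, $$X(k)=\begin{bmatrix} e^{ik\underline a_d}& e^{-ik\underline a_d}&0\\ \mathbb 1&\mathbb 1&0\\0&0&\tfrac1{\sqrt2}(\mathbb 1+e^{k^2\underline a_t})\end{bmatrix},\qquad Y(k)=\begin{bmatrix} ike^{ik\underline a_d}& -ike^{-ik\underline a_d}&0\\ -ik\mathbb 1&ik\mathbb 1&0\\0&0&\tfrac1{\sqrt2}(\mathbb 1-e^{k^2\underline a_t})\end{bmatrix},$$ where $e^{\pm ik\underline a_d}$ is the $D\times D$ diagonal matrix with entries $e^{\pm ik a_{di}}$, $e^{k^2\underline a_t}$ is the $T\times T$ diagonal matrix with entries $e^{k^2a_{tj}}$, and $\mathbb 1$ denotes identity matrices of appropriate size. *)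

theory Defs
  imports
    "HOL-Analysis.Analysis"
    "HOL-Library.Function_Algebras"
    "Jordan_Normal_Form.Schur_Decomposition"
    "Jordan_Normal_Form.Matrix_Kernel"
begin

section \<open>Functions on the line modulo equality almost everywhere\<close>

quotient_type aefun = "real \<Rightarrow> complex" / "\<lambda>f g. AE x in lebesgue. f x = g x"
  morphisms rep_aefun abs_aefun
proof (rule equivpI)
  show "reflp (\<lambda>f g :: real \<Rightarrow> complex. AE x in lebesgue. f x = g x)"
    by (auto intro: reflpI)
  show "symp (\<lambda>f g :: real \<Rightarrow> complex. AE x in lebesgue. f x = g x)"
    by (rule sympI, erule eventually_mono) simp
  show "transp (\<lambda>f g :: real \<Rightarrow> complex. AE x in lebesgue. f x = g x)"
    by (rule transpI, erule (1) eventually_elim2) simp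
qed

instantiation aefun :: ab_group_add
begin

lift_definition zero_aefun :: aefun is "\<lambda>x. 0" .

lift_definition plus_aefun :: "aefun \<Rightarrow> aefun \<Rightarrow> aefun" is "\<lambda>f g x. f x + g x"
  by (erule (1) eventually_elim2) simp

lift_definition minus_aefun :: "aefun \<Rightarrow> aefun \<Rightarrow> aefun" is "\<lambda>f g x. f x - g x"
  by (erule (1) eventually_elim2) simp

lift_definition uminus_aefun :: "aefun \<Rightarrow> aefun" is "\<lambda>f x. - f x"
  by (erule eventually_mono) simp

instance
  by (standard; transfer; simp)

end

lift_definition scale_aefun :: "complex \<Rightarrow> aefun \<Rightarrow> aefun" is "\<lambda>c f x. c * f x"
  by (erule eventually_mono) simp


section \<open>Sobolev spaces on an interval\<close>

text \<open>
  The space \<open>L\<^sup>2(0,a)\<close> is embedded into the classes of functions on the line through extension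
  by zero. Lebesgue measure is complete, so none of the notions below depends on the
  representative that \<^const>\<open>rep_aefun\<close> chooses.
\<close>

definition L2 :: "real \<Rightarrow> aefun set" where
  "L2 a = {u. rep_aefun u \<in> borel_measurable lebesgue
            \<and> integrable lebesgue (\<lambda>x. (cmod (rep_aefun u x))\<^sup>2)
            \<and> (AE x in lebesgue. x \<notin> {0<..<a} \<longrightarrow> rep_aefun u x = 0)}"

definition test_function :: "real \<Rightarrow> (real \<Rightarrow> complex) \<Rightarrow> bool" where
  "test_function a \<phi> \<longleftrightarrow> \<phi> C1_differentiable_on UNIV \<and> closure {x. \<phi> x \<noteq> 0} \<subseteq> {0<..<a}"

definition has_weak_deriv :: "real \<Rightarrow> aefun \<Rightarrow> aefun \<Rightarrow> bool" where
  "has_weak_deriv a u g \<longleftrightarrow>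
     (\<forall>\<phi>. test_function a \<phi> \<longrightarrow>
        (LINT x:{0<..<a}|lebesgue. rep_aefun u x * vector_derivative \<phi> (at x))
      = - (LINT x:{0<..<a}|lebesgue. rep_aefun g x * \<phi> x))"

text \<open>\<open>sobolev m a\<close> is \<open>H\<^sup>m(0,a)\<close>, without boundary conditions.\<close>

fun sobolev :: "nat \<Rightarrow> real \<Rightarrow> aefun set" where
  "sobolev 0 a = L2 a"
| "sobolev (Suc m) a = {u \<in> L2 a. \<exists>g \<in> sobolev m a. has_weak_deriv a u g}"

definition weak_deriv :: "real \<Rightarrow> aefun \<Rightarrow> aefun" where
  "weak_deriv a u = (THE g. g \<in> L2 a \<and> has_weak_deriv a u g)"

text \<open>The value at \<open>x\<close> of the representative of \<open>u\<close> that is continuous on \<open>[0,a]\<close>.\<close>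

definition point_value :: "real \<Rightarrow> aefun \<Rightarrow> real \<Rightarrow> complex" where
  "point_value a u x = (THE c. \<exists>f. continuous_on {0..a} f
      \<and> (AE y in lebesgue. y \<in> {0<..<a} \<longrightarrow> rep_aefun u y = f y) \<and> f x = c)"


section \<open>Functions on the edges and boundary values\<close>

text \<open>
  The lists \<open>a\<^sub>d\<close> and \<open>a\<^sub>t\<close> hold the lengths of the diffusion and of the transport edges. A pair
  \<open>(ud, ut)\<close> of families of edge functions is zero beyond the ranges of the edge indices.
  The boundary space is \<open>\<complex>\<^sup>n\<close> with \<open>n = boundary_dim a\<^sub>d a\<^sub>t\<close>.
\<close>

type_synonym edge_fun = "(nat \<Rightarrow> aefun) \<times> (nat \<Rightarrow> aefun)"

definition scale_edge_fun :: "complex \<Rightarrow> edge_fun \<Rightarrow> edge_fun" where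
  "scale_edge_fun c u = (\<lambda>i. scale_aefun c (fst u i), \<lambda>j. scale_aefun c (snd u j))"

lemma scale_aefun_simps:
  "scale_aefun c (u + v) = scale_aefun c u + scale_aefun c v"
  "scale_aefun (c + d) u = scale_aefun c u + scale_aefun d u"
  "scale_aefun c (scale_aefun d u) = scale_aefun (c * d) u"
  "scale_aefun 1 u = u"
  by (transfer; simp add: algebra_simps)+

global_interpretation edge_fun: vector_space scale_edge_fun
  by standard (auto simp: scale_edge_fun_def scale_aefun_simps plus_fun_def prod_eq_iff)

definition edge_sobolev :: "real list \<Rightarrow> real list \<Rightarrow> edge_fun set" where
  "edge_sobolev a\<^sub>d a\<^sub>t = {(ud, ut).
      (\<forall>i < length a\<^sub>d. ud i \<in> sobolev 2 (a\<^sub>d ! i)) \<and> (\<forall>i \<ge> length a\<^sub>d. ud i = 0) \<and>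
      (\<forall>j < length a\<^sub>t. ut j \<in> sobolev 1 (a\<^sub>t ! j)) \<and> (\<forall>j \<ge> length a\<^sub>t. ut j = 0)}"

definition boundary_dim :: "real list \<Rightarrow> real list \<Rightarrow> nat" where
  "boundary_dim a\<^sub>d a\<^sub>t = length a\<^sub>d + length a\<^sub>d + length a\<^sub>t"

definition boundary_values :: "real list \<Rightarrow> real list \<Rightarrow> edge_fun \<Rightarrow> complex Matrix.vec" where
  "boundary_values a\<^sub>d a\<^sub>t = (\<lambda>(ud, ut).
     Matrix.vec (length a\<^sub>d) (\<lambda>i. point_value (a\<^sub>d ! i) (ud i) (a\<^sub>d ! i)) @\<^sub>v
     Matrix.vec (length a\<^sub>d) (\<lambda>i. point_value (a\<^sub>d ! i) (ud i) 0) @\<^sub>v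
     Matrix.vec (length a\<^sub>t) (\<lambda>j. complex_of_real (1 / sqrt 2) *
       (point_value (a\<^sub>t ! j) (ut j) (a\<^sub>t ! j) + point_value (a\<^sub>t ! j) (ut j) 0)))"

definition boundary_derivs :: "real list \<Rightarrow> real list \<Rightarrow> edge_fun \<Rightarrow> complex Matrix.vec" where
  "boundary_derivs a\<^sub>d a\<^sub>t = (\<lambda>(ud, ut).
     Matrix.vec (length a\<^sub>d) (\<lambda>i. point_value (a\<^sub>d ! i) (weak_deriv (a\<^sub>d ! i) (ud i)) (a\<^sub>d ! i)) @\<^sub>v
     Matrix.vec (length a\<^sub>d) (\<lambda>i. - point_value (a\<^sub>d ! i) (weak_deriv (a\<^sub>d ! i) (ud i)) 0) @\<^sub>v
     Matrix.vec (length a\<^sub>t) (\<lambda>j. complex_of_real (1 / sqrt 2) *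
       (- point_value (a\<^sub>t ! j) (ut j) (a\<^sub>t ! j) + point_value (a\<^sub>t ! j) (ut j) 0)))"


section \<open>The operator\<close>

definition orthogonal_projector :: "nat \<Rightarrow> complex Matrix.mat \<Rightarrow> bool" where
  "orthogonal_projector n P \<longleftrightarrow> P \<in> carrier_mat n n \<and> P * P = P \<and> mat_adjoint P = P"

text \<open>
  \<open>L\<close> maps \<open>Ker P\<close> into itself and vanishes on \<open>Ran P\<close>, the orthogonal complement of \<open>Ker P\<close>
  for an orthogonal projector \<open>P\<close>.
\<close>

definition acts_in_kernel :: "nat \<Rightarrow> complex Matrix.mat \<Rightarrow> complex Matrix.mat \<Rightarrow> bool" where
  "acts_in_kernel n P L \<longleftrightarrow> L \<in> carrier_mat n n
     \<and> (\<forall>v \<in> mat_kernel P. L *\<^sub>v v \<in> mat_kernel P)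
     \<and> (\<forall>v \<in> carrier_vec n. L *\<^sub>v (P *\<^sub>v v) = 0\<^sub>v n)"

definition perp :: "nat \<Rightarrow> complex Matrix.mat \<Rightarrow> complex Matrix.mat" where
  "perp n P = 1\<^sub>m n - P"

definition graph_op_domain ::
  "real list \<Rightarrow> real list \<Rightarrow> complex Matrix.mat \<Rightarrow> complex Matrix.mat \<Rightarrow> edge_fun set" where
  "graph_op_domain a\<^sub>d a\<^sub>t P L = {u \<in> edge_sobolev a\<^sub>d a\<^sub>t.
     perp (boundary_dim a\<^sub>d a\<^sub>t) P *\<^sub>v boundary_derivs a\<^sub>d a\<^sub>t u
       + (L + P) *\<^sub>v boundary_values a\<^sub>d a\<^sub>t u = 0\<^sub>v (boundary_dim a\<^sub>d a\<^sub>t)}"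

definition graph_op :: "real list \<Rightarrow> real list \<Rightarrow> edge_fun \<Rightarrow> edge_fun" where
  "graph_op a\<^sub>d a\<^sub>t = (\<lambda>(ud, ut).
     (\<lambda>i. if i < length a\<^sub>d then weak_deriv (a\<^sub>d ! i) (weak_deriv (a\<^sub>d ! i) (ud i)) else 0,
      \<lambda>j. if j < length a\<^sub>t then - weak_deriv (a\<^sub>t ! j) (ut j) else 0))"

definition is_eigenvalue :: "edge_fun set \<Rightarrow> (edge_fun \<Rightarrow> edge_fun) \<Rightarrow> complex \<Rightarrow> bool" where
  "is_eigenvalue \<D> A \<mu> \<longleftrightarrow> (\<exists>u \<in> \<D>. u \<noteq> 0 \<and> A u = scale_edge_fun \<mu> u)"

definition eigenspace :: "edge_fun set \<Rightarrow> (edge_fun \<Rightarrow> edge_fun) \<Rightarrow> complex \<Rightarrow> edge_fun set" where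
  "eigenspace \<D> A \<mu> = {u \<in> \<D>. A u = scale_edge_fun \<mu> u}"

text \<open>
  \<^const>\<open>edge_fun.dim\<close> is \<open>0\<close> on infinite-dimensional spaces, hence the separate finiteness
  condition.
\<close>

definition has_geometric_multiplicity ::
  "edge_fun set \<Rightarrow> (edge_fun \<Rightarrow> edge_fun) \<Rightarrow> complex \<Rightarrow> nat \<Rightarrow> bool" where
  "has_geometric_multiplicity \<D> A \<mu> m \<longleftrightarrow>
     (\<exists>B. finite B \<and> eigenspace \<D> A \<mu> \<subseteq> edge_fun.span B) \<and>
     edge_fun.dim (eigenspace \<D> A \<mu>) = m"


section \<open>The matrices\<close>

definition exp_diag :: "complex \<Rightarrow> real list \<Rightarrow> complex Matrix.mat" where
  "exp_diag z a = mat_diag (length a) (\<lambda>i. exp (z * complex_of_real (a ! i)))"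

definition X_mat :: "real list \<Rightarrow> real list \<Rightarrow> complex \<Rightarrow> complex Matrix.mat" where
  "X_mat a\<^sub>d a\<^sub>t k = (let d = length a\<^sub>d; t = length a\<^sub>t in
     four_block_mat
       (four_block_mat
          (exp_diag (\<i> * k) a\<^sub>d) (exp_diag (- \<i> * k) a\<^sub>d)
          (1\<^sub>m d)               (1\<^sub>m d))
       (0\<^sub>m (d + d) t)
       (0\<^sub>m t (d + d))
       (complex_of_real (1 / sqrt 2) \<cdot>\<^sub>m (1\<^sub>m t + exp_diag (k\<^sup>2) a\<^sub>t)))"

definition Y_mat :: "real list \<Rightarrow> real list \<Rightarrow> complex \<Rightarrow> complex Matrix.mat" where
  "Y_mat a\<^sub>d a\<^sub>t k = (let d = length a\<^sub>d; t = length a\<^sub>t in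
     four_block_mat
       (four_block_mat
          ((\<i> * k) \<cdot>\<^sub>m exp_diag (\<i> * k) a\<^sub>d) ((- \<i> * k) \<cdot>\<^sub>m exp_diag (- \<i> * k) a\<^sub>d)
          ((- \<i> * k) \<cdot>\<^sub>m 1\<^sub>m d)               ((\<i> * k) \<cdot>\<^sub>m 1\<^sub>m d))
       (0\<^sub>m (d + d) t)
       (0\<^sub>m t (d + d))
       (complex_of_real (1 / sqrt 2) \<cdot>\<^sub>m (1\<^sub>m t - exp_diag (k\<^sup>2) a\<^sub>t)))"

definition Z_mat :: "real list \<Rightarrow> real list \<Rightarrow> complex Matrix.mat \<Rightarrow> complex Matrix.mat
    \<Rightarrow> complex \<Rightarrow> complex Matrix.mat" where
  "Z_mat a\<^sub>d a\<^sub>t P L k = (P + L) * X_mat a\<^sub>d a\<^sub>t k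
     + perp (boundary_dim a\<^sub>d a\<^sub>t) P * Y_mat a\<^sub>d a\<^sub>t k"

end

theory Submission
  imports Defs
begin

text \<open>
  An integrable function \<open>v\<close> on \<open>(0,a)\<close> with \<open>v' = c v\<close> weakly is a multiple of \<open>exp (c x)\<close>: testing
  against \<open>\<phi> x * exp (- c * x)\<close> shows that \<open>v x * exp (- c * x)\<close> has weak derivative \<open>0\<close>, so it is
  constant by the du Bois-Reymond lemma. On transport edges this is the eigenvalue equation with
  \<open>c = k\<^sup>2\<close>. On diffusion edges \<open>u' + \<i> k u\<close> and \<open>u' - \<i> k u\<close> satisfy such equations, hence
  \<open>u\<close> is a combination of \<open>exp (\<i> k x)\<close> and \<open>exp (- \<i> k x)\<close>. The coefficients of
  these exponentials thus parametrise, linearly and injectively, all functions satisfying the eigenvalue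
  equation on the edges; \<open>X k\<close> and \<open>Y k\<close> map them to the boundary values and derivatives, and the
  boundary condition says that they lie in the kernel of \<open>Z k\<close>.
\<close>

section \<open>Test functions and the du Bois-Reymond lemma\<close>

lemma test_functionI:
  assumes "\<phi> C1_differentiable_on UNIV" "0 < p" "q < a" "\<And>x. x \<notin> {p..q} \<Longrightarrow> \<phi> x = 0"
  shows "test_function a \<phi>"
proof -
  have "closure {x. \<phi> x \<noteq> 0} \<subseteq> {p..q}"
  proof (rule closure_minimal)
    show "{x. \<phi> x \<noteq> 0} \<subseteq> {p..q}" using assms(4) by blast
  qed simp
  then show ?thesis
    using assms by (auto simp: test_function_def)
qed

lemma test_function_support:
  assumes "test_function a \<phi>" "0 < a"
  obtains p q where "0 < p" "p < q" "q < a" "\<And>x. x \<notin> {p..q} \<Longrightarrow> \<phi> x = 0"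
proof -
  \<comment> \<open>The two extra points keep the compact set nonempty and its minimum strictly
    below its maximum, so that \<open>p < q\<close> holds also for \<phi> = 0.\<close>
  let ?S = "closure {x. \<phi> x \<noteq> 0} \<union> {a/3, a/2}"
  have sub: "?S \<subseteq> {0<..<a}"
    using assms by (auto simp: test_function_def)
  then have "bounded ?S"
    by (rule bounded_subset[rotated]) simp
  then have comp: "compact ?S"
    unfolding compact_eq_bounded_closed by (auto intro: finite_imp_closed)
  obtain p where p: "p \<in> ?S" "\<And>x. x \<in> ?S \<Longrightarrow> p \<le> x"
    using compact_attains_inf[OF comp] by blast
  obtain q where q: "q \<in> ?S" "\<And>x. x \<in> ?S \<Longrightarrow> x \<le> q"
    using compact_attains_sup[OF comp] by blast
  have "p \<le> a/3" "a/2 \<le> q"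
    using p(2)[of "a/3"] q(2)[of "a/2"] by auto
  moreover have "\<phi> x = 0" if "x \<notin> {p..q}" for x
    using that p(2)[of x] q(2)[of x] closure_subset[of "{x. \<phi> x \<noteq> 0}"] by force
  ultimately show thesis
    using sub p(1) q(1) assms(2) by (intro that[of p q]) auto
qed

lemma test_function_vector_derivative:
  assumes "test_function a \<phi>"
  shows "(\<phi> has_vector_derivative vector_derivative \<phi> (at x)) (at x)"
    "continuous_on S \<phi>" "continuous_on S (\<lambda>x. vector_derivative \<phi> (at x))"
proof -
  have C1: "\<forall>x. \<phi> differentiable at x" "continuous_on UNIV (\<lambda>x. vector_derivative \<phi> (at x))"
    using assms by (auto simp: test_function_def C1_differentiable_on_eq)
  show "(\<phi> has_vector_derivative vector_derivative \<phi> (at x)) (at x)"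
    using C1 vector_derivative_works by blast
  show "continuous_on S \<phi>"
    using C1 by (auto intro: continuous_at_imp_continuous_on differentiable_imp_continuous_within)
  show "continuous_on S (\<lambda>x. vector_derivative \<phi> (at x))"
    using C1 continuous_on_subset by blast
qed

lemma test_function_mult:
  assumes "test_function a \<phi>" "f C1_differentiable_on UNIV"
  shows "test_function a (\<lambda>x. \<phi> x * f x)"
proof -
  have "closure {x. \<phi> x * f x \<noteq> 0} \<subseteq> closure {x. \<phi> x \<noteq> 0}"
    by (intro closure_mono) auto
  then show ?thesis
    using assms by (auto simp: test_function_def)
qed

text \<open>The continuous factor is bounded on the compact interval \<open>{0..a}\<close>, so a
  multiple of \<open>g\<close> dominates the product.\<close>

lemma set_integrable_mult_continuous:
  fixes g :: "real \<Rightarrow> complex"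
  assumes "set_integrable lebesgue {0<..<a} g" "continuous_on UNIV f"
  shows "set_integrable lebesgue {0<..<a} (\<lambda>x. g x * f x)"
proof -
  have "bounded (f ` {0..a})"
    using assms(2) by (intro compact_imp_bounded compact_continuous_image continuous_on_subset[OF assms(2)]) auto
  then obtain B where B: "\<And>x. x \<in> {0..a} \<Longrightarrow> norm (f x) \<le> B"
    unfolding bounded_iff by blast
  have meas: "f \<in> borel_measurable lebesgue"
    using borel_measurable_continuous_onI[OF assms(2)] by (simp add: measurable_completion)
  have "(\<lambda>x. (indicator {0<..<a} x *\<^sub>R g x) * f x) \<in> borel_measurable lebesgue"
    using assms(1) meas by (intro borel_measurable_times) (auto simp: set_integrable_def)
  then have m: "(\<lambda>x. indicator {0<..<a} x *\<^sub>R (g x * f x)) \<in> borel_measurable lebesgue"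
    by (simp add: mult_scaleR_left)
  have "set_integrable lebesgue {0<..<a} (\<lambda>x. of_real B * g x)"
    using assms(1) by simp
  then show ?thesis
  proof (rule set_integrable_bound)
    show "set_borel_measurable lebesgue {0<..<a} (\<lambda>x. g x * f x)"
      using m by (simp add: set_borel_measurable_def)
    show "AE x in lebesgue. x \<in> {0<..<a} \<longrightarrow> norm (g x * f x) \<le> norm (of_real B * g x)"
    proof (intro AE_I2 impI)
      fix x assume "x \<in> {0<..<a}"
      then have "norm (f x) \<le> \<bar>B\<bar>" using B[of x] by auto
      then show "norm (g x * f x) \<le> norm (of_real B * g x)"
        by (simp add: norm_mult mult.commute mult_right_mono)
    qed
  qed
qed

section \<open>Continuously differentiable cut-offs approximating the indicator of an
  interval\<close>

text \<open>Squaring removes the kink of the positive part at 0; one continuous derivative is all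
  that \<open>test_function\<close> asks of the cut-offs built from it.\<close>

lemma has_real_derivative_max_0_power2:
  "((\<lambda>y::real. (max 0 y)\<^sup>2) has_real_derivative 2 * max 0 y) (at y)"
proof -
  consider "y < 0" | "y > 0" | "y = 0" by linarith
  then show ?thesis
  proof cases
    case 1
    have "((\<lambda>y::real. 0) has_real_derivative 0) (at y)" by simp
    then have "((\<lambda>y::real. (max 0 y)\<^sup>2) has_real_derivative 0) (at y)"
      using 1 by (elim has_field_derivative_transform_within_open[of _ _ _ "{..<0}"]) auto
    then show ?thesis using 1 by simp
  next
    case 2
    have "((\<lambda>y::real. y\<^sup>2) has_real_derivative 2 * y) (at y)"
      by (auto intro!: derivative_eq_intros)
    then have "((\<lambda>y::real. (max 0 y)\<^sup>2) has_real_derivative 2 * y) (at y)"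
      using 2 by (elim has_field_derivative_transform_within_open[of _ _ _ "{0<..}"]) auto
    then show ?thesis using 2 by simp
  next
    case 3
    have "(\<lambda>h::real. (max 0 h)\<^sup>2 / h) \<midarrow>0\<rightarrow> 0"
    proof (rule Lim_null_comparison)
      show "\<forall>\<^sub>F h in at 0. norm ((max 0 h)\<^sup>2 / h) \<le> \<bar>h::real\<bar>"
        by (intro always_eventually allI) (auto simp: max_def power2_eq_square)
    qed (auto intro!: tendsto_eq_intros)
    then show ?thesis using 3 by (simp add: DERIV_def)
  qed
qed

text \<open>The shift by \<open>1 / Suc n\<close> keeps the support away from the end points of \<open>(0,q)\<close>.\<close>

definition bump :: "real \<Rightarrow> nat \<Rightarrow> real \<Rightarrow> real" where
  "bump q n x = (let y = real n * (max 0 (x * (q - x) - 1 / Suc n))\<^sup>2 in y / (1 + y))"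

lemma bump_bounds: "0 \<le> bump q n x" "bump q n x \<le> 1"
proof -
  have "0 \<le> real n * (max 0 (x * (q - x) - 1 / Suc n))\<^sup>2" by simp
  moreover have "0 \<le> y / (1 + y)" "y / (1 + y) \<le> 1" if "0 \<le> y" for y :: real
    using that by (auto simp: divide_le_eq_1)
  ultimately show "0 \<le> bump q n x" "bump q n x \<le> 1"
    unfolding bump_def Let_def by blast+
qed

text \<open>With y the quantity named in \<open>bump\<close>, the value is 1 - 1 / (1 + y). Inside
  the interval y grows like n times a positive limit; outside, x (q - x) is nonpositive and the
  positive part is 0.\<close>

lemma bump_tendsto: "(\<lambda>n. bump q n x) \<longlonglongrightarrow> indicat_real {0<..<q} x" if "0 < q"
proof (cases "x \<in> {0<..<q}")
  case True
  define w where "w = x * (q - x)"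
  have w: "w > 0" using True by (simp add: w_def)
  have "(\<lambda>n. 1 / real (Suc n)) \<longlonglongrightarrow> 0" by (rule lim_1_over_n[THEN LIMSEQ_Suc])
  then have "(\<lambda>n. (max 0 (w - 1 / Suc n))\<^sup>2) \<longlonglongrightarrow> (max 0 (w - 0))\<^sup>2"
    by (intro tendsto_intros)
  then have "LIM n sequentially. (max 0 (w - 1 / Suc n))\<^sup>2 * real n :> at_top"
    using w by (intro filterlim_tendsto_pos_mult_at_top[of _ "(max 0 (w - 0))\<^sup>2"] filterlim_real_sequentially) auto
  then have L: "LIM n sequentially. 1 + real n * (max 0 (w - 1 / Suc n))\<^sup>2 :> at_top"
    by (intro filterlim_tendsto_add_at_top[of _ 1]) (auto simp: mult.commute)
  have "(\<lambda>n. 1 - inverse (1 + real n * (max 0 (w - 1 / Suc n))\<^sup>2)) \<longlonglongrightarrow> 1 - 0"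
    by (intro tendsto_intros tendsto_inverse_0_at_top L)
  moreover have "bump q n x = 1 - inverse (1 + real n * (max 0 (w - 1 / Suc n))\<^sup>2)" for n
  proof -
    have "1 + real n * (max 0 (w - 1 / Suc n))\<^sup>2 > 0"
      by (rule add_pos_nonneg) auto
    then show ?thesis unfolding bump_def Let_def w_def by (simp add: field_simps)
  qed
  ultimately show ?thesis using True by simp
next
  case False
  then have "x * (q - x) \<le> 0" using that by (auto simp: mult_le_0_iff)
  then have "bump q n x = 0" for n
    by (auto simp: bump_def Let_def max_def)
       (smt (verit) divide_nonneg_nonneg of_nat_0_le_iff)
  then show ?thesis using False by simp
qed

lemma test_function_bump:
  assumes "0 < q" "q \<le> a"
  shows "test_function a (\<lambda>x. of_real (bump q n x))"
proof -
  define y where "y x = real n * (max 0 (x * (q - x) - 1 / Suc n))\<^sup>2" for x :: real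
  define y' where "y' x = real n * (2 * max 0 (x * (q - x) - 1 / Suc n) * (q - 2 * x))" for x :: real
  have y0: "y x \<ge> 0" for x by (simp add: y_def)
  have pos: "1 + y x > 0" for x using y0[of x] by linarith
  have yd: "(y has_real_derivative y' x) (at x)" for x
    unfolding y_def y'_def
    by (intro DERIV_cmult DERIV_chain'[OF _ has_real_derivative_max_0_power2, THEN DERIV_cong])
       (auto intro!: derivative_eq_intros simp: algebra_simps)
  have "((\<lambda>x. y x / (1 + y x)) has_real_derivative (y' x / (1 + y x)\<^sup>2)) (at x)" for x
    using pos[of x] by (auto intro!: derivative_eq_intros yd simp: field_simps power2_eq_square)
  then have "((\<lambda>x. complex_of_real (y x / (1 + y x))) has_vector_derivative of_real (y' x / (1 + y x)\<^sup>2)) (at x)" for x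
    by (intro has_vector_derivative_of_real) (simp add: has_real_derivative_iff_has_vector_derivative)
  moreover have "continuous_on UNIV y"
    using yd DERIV_isCont continuous_at_imp_continuous_on by blast
  then have "continuous_on UNIV (\<lambda>x. complex_of_real (y' x / (1 + y x)\<^sup>2))"
    unfolding y'_def using pos by (intro continuous_intros ballI) (auto simp: less_imp_neq[symmetric])
  ultimately have C1: "(\<lambda>x. complex_of_real (y x / (1 + y x))) C1_differentiable_on UNIV"
    unfolding C1_differentiable_on_def by (intro exI[of _ "\<lambda>x. of_real (y' x / (1 + y x)\<^sup>2)"]) simp
  \<comment> \<open>A closed set containing all points where the function is nonzero contains their
    closure too; its positive threshold keeps it away from 0 and \<open>q\<close>.\<close>
  let ?C = "{x. 1 / Suc n \<le> x * (q - x)}"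
  have "closure {x. complex_of_real (bump q n x) \<noteq> 0} \<subseteq> ?C"
  proof (rule closure_minimal)
    show "closed ?C" by (intro closed_Collect_le continuous_intros)
  qed (auto simp: bump_def Let_def max_def split: if_splits)
  also have "?C \<subseteq> {0<..<a}"
  proof
    fix x assume "x \<in> ?C"
    then have "0 < x * (q - x)"
      by (smt (verit) divide_pos_pos mem_Collect_eq of_nat_0_less_iff zero_less_Suc)
    then show "x \<in> {0<..<a}" using assms by (auto simp: zero_less_mult_iff)
  qed
  finally show ?thesis
    using C1 unfolding test_function_def by (simp add: bump_def y_def Let_def)
qed

section \<open>From vanishing integrals to vanishing almost everywhere\<close>

text \<open>Supplies the locale in which \<open>density_zero\<close> is applied to
  \<open>lebesgue\<close>.\<close>

lemma sigma_finite_lebesgue: "sigma_finite_measure (lebesgue :: real measure)"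
proof (intro sigma_finite_measure.intro exI conjI)
  let ?F = "range (\<lambda>n::nat. {- real n..real n})"
  show "countable ?F" "?F \<subseteq> sets lebesgue" by auto
  show "\<Union>?F = space (lebesgue :: real measure)"
  proof (auto)
    fix x :: real
    obtain n :: nat where "\<bar>x\<bar> \<le> real n" using real_arch_simple by blast
    then show "\<exists>n::nat. - real n \<le> x \<and> x \<le> real n" by (intro exI[of _ n]) auto
  qed
  show "\<forall>A\<in>?F. emeasure lebesgue A \<noteq> \<infinity>" by auto
qed

text \<open>Dynkin argument: half-lines are an intersection-stable generator of the Borel sets, and
  the Borel sets on which \<open>h\<close> integrates to 0 are closed under complements and
  countable disjoint unions. A Lebesgue set differs from a Borel set by a null set, and
  \<open>density_zero\<close> concludes.\<close>

lemma AE_eq_0_if_integral_lessThan: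
  fixes h :: "real \<Rightarrow> complex"
  assumes h: "integrable lebesgue h" and zero: "\<And>q. (LINT x:{..<q}|lebesgue. h x) = 0"
  shows "AE x in lebesgue. h x = 0"
proof -
  have si: "set_integrable lebesgue S h" if "S \<in> sets lebesgue" for S
    using integrable_mult_indicator[OF that h] by (simp add: set_integrable_def)
  \<comment> \<open>Complements need the integral over the whole line, which is the limit of the
    integrals over \<open>{..<real n}\<close>.\<close>
  have total: "integral\<^sup>L lebesgue h = 0"
  proof -
    have "(\<lambda>n. LINT x:{..<real n}|lebesgue. h x) \<longlonglongrightarrow> (LINT x:(\<Union>n. {..<real n})|lebesgue. h x)"
      by (intro set_integral_cont_up) (auto simp: incseq_def intro!: si)
    moreover have "(\<Union>n. {..<real n}) = UNIV"
      using reals_Archimedean2 by auto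
    ultimately have "(LINT x:UNIV|lebesgue. h x) = 0"
      using zero LIMSEQ_unique tendsto_const by (metis (no_types, lifting) ext)
    then show ?thesis by (simp add: set_lebesgue_integral_def)
  qed
  have borel: "(LINT x:S|lebesgue. h x) = 0" if "S \<in> sets borel" for S
  proof -
    have mem: "S \<in> sigma_sets UNIV (range lessThan)"
      using that by (simp add: borel_Iio[where 'a=real])
    have leb: "B \<in> sets lebesgue" if "B \<in> sigma_sets UNIV (range lessThan)" for B :: "real set"
    proof -
      have "B \<in> sets borel" using that by (simp add: borel_Iio[where 'a=real])
      then show ?thesis by simp
    qed
    have stable: "Int_stable (range (lessThan :: real \<Rightarrow> _))"
      unfolding Int_stable_def
    proof (clarify)
      fix a b :: real
      have "{..<a} \<inter> {..<b} = {..<min a b}" by auto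
      then show "{..<a} \<inter> {..<b} \<in> range lessThan" by simp
    qed
    have "range lessThan \<subseteq> Pow UNIV" by simp
    from stable this mem show ?thesis
    proof (induction rule: sigma_sets_induct_disjoint)
      case (basic S) then show ?case using zero by auto
    next
      case empty show ?case by (simp add: set_lebesgue_integral_def)
    next
      case (compl S)
      then have S: "S \<in> sets lebesgue" by (intro leb)
      have "(LINT x:S \<union> (UNIV - S)|lebesgue. h x) = (LINT x:S|lebesgue. h x) + (LINT x:UNIV - S|lebesgue. h x)"
        using S by (intro set_integral_Un si) auto
      then show ?case using compl total by (simp add: set_lebesgue_integral_def)
    next
      case (union S)
      then have S: "S i \<in> sets lebesgue" for i
        by (intro leb) auto
      have "(LINT x:(\<Union>i. S i)|lebesgue. h x) = (\<Sum>i. LINT x:S i|lebesgue. h x)"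
        using union S by (intro lebesgue_integral_countable_add si) (auto simp: disjoint_family_on_def)
      then show ?case using union by simp
    qed
  qed
  interpret sigma_finite_measure "lebesgue :: real measure" by (rule sigma_finite_lebesgue)
  show ?thesis
  proof (rule density_zero[OF h])
    fix A :: "real set" assume A: "A \<in> sets lebesgue"
    obtain S N N' where S: "A = S \<union> N" "N \<subseteq> N'" "N' \<in> null_sets lborel" "S \<in> sets lborel"
      using A by (rule sets_completionE)
    have "N' \<in> null_sets lebesgue"
      using S(3) by (rule null_sets_completionI)
    then have "AE x in lebesgue. x \<notin> N'" by (rule AE_not_in)
    then have "(LINT x:A|lebesgue. h x) = (LINT x:S|lebesgue. h x)"
      unfolding set_lebesgue_integral_def
      using A S(4) si[of A] si[of S] unfolding set_integrable_def
      by (intro integral_cong_AE)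
         (auto elim!: eventually_mono simp: S(1) indicator_def intro: S(2)[THEN subsetD])
    then show "(LINT x:A|lebesgue. h x) = 0" using borel S(4) by simp
  qed
qed


text \<open>The functions \<open>bump\<close> converge boundedly to the indicator of an interval
  starting at 0, so dominated convergence turns the hypothesis into vanishing integrals over
  half-lines.\<close>

lemma AE_eq_0_if_test_functions:
  fixes g :: "real \<Rightarrow> complex"
  assumes g: "set_integrable lebesgue {0<..<a} g"
    and zero: "\<And>\<phi>. test_function a \<phi> \<Longrightarrow> (LINT x:{0<..<a}|lebesgue. g x * \<phi> x) = 0"
  shows "AE x in lebesgue. x \<in> {0<..<a} \<longrightarrow> g x = 0"
proof -
  define h where "h x = indicator {0<..<a} x *\<^sub>R g x" for x
  have h: "integrable lebesgue h"
    using g by (simp add: set_integrable_def h_def[abs_def])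
  have "(LINT x:{..<q}|lebesgue. h x) = 0" for q
  proof (cases "0 < min q a")
    case False
    then have "(\<lambda>x. indicator {..<q} x *\<^sub>R h x) = (\<lambda>x. 0)"
      by (auto simp: h_def indicator_def fun_eq_iff)
    then show ?thesis by (simp add: set_lebesgue_integral_def)
  next
    case True
    \<comment> \<open>Since \<open>h\<close> is 0 off (0,a), integrating over the half-line below
      \<open>q\<close> amounts to integrating over (0,r), an interval that the bumps fill from
      inside.\<close>
    define r where "r = min q a"
    have r: "0 < r" "r \<le> a" using True by (auto simp: r_def)
    have lim: "(\<lambda>n. LINT x|lebesgue. h x * of_real (bump r n x))
        \<longlonglongrightarrow> (LINT x|lebesgue. h x * of_real (indicator {0<..<r} x))"
    proof (rule integral_dominated_convergence[where w = "\<lambda>x. norm (h x)"])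
      have m: "(\<lambda>x. complex_of_real (bump r n x)) \<in> borel_measurable lebesgue" for n
        using test_function_vector_derivative(2)[OF test_function_bump[OF r]]
        by (intro measurable_completion) (simp add: borel_measurable_continuous_onI)
      show "(\<lambda>x. h x * of_real (bump r n x)) \<in> borel_measurable lebesgue" for n
        using h m[of n] by (intro borel_measurable_times) auto
      show "(\<lambda>x. h x * of_real (indicator {0<..<r} x)) \<in> borel_measurable lebesgue"
      proof (intro borel_measurable_times)
        show "(\<lambda>x. complex_of_real (indicator {0<..<r} x)) \<in> borel_measurable lebesgue"
          by (intro measurable_completion) measurable
      qed (use h in auto)
      show "AE x in lebesgue. (\<lambda>n. h x * of_real (bump r n x)) \<longlonglongrightarrow> h x * of_real (indicator {0<..<r} x)"
        by (intro AE_I2 tendsto_intros bump_tendsto r)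
      show "AE x in lebesgue. norm (h x * of_real (bump r n x)) \<le> norm (h x)" for n
        using bump_bounds[of r n] by (intro AE_I2) (auto simp: norm_mult intro: mult_left_le)
    qed (use h in auto)
    have "(LINT x|lebesgue. h x * of_real (bump r n x)) = 0" for n
      using zero[OF test_function_bump[OF r]] by (simp add: set_lebesgue_integral_def h_def mult_scaleR_left)
    then have "(LINT x|lebesgue. h x * of_real (indicator {0<..<r} x)) = 0"
      using LIMSEQ_unique[OF lim] by simp
    moreover have "h x * of_real (indicator {0<..<r} x) = indicator {..<q} x *\<^sub>R h x" for x
      by (auto simp: h_def r_def indicator_def)
    ultimately show ?thesis by (simp add: set_lebesgue_integral_def)
  qed
  then have "AE x in lebesgue. h x = 0"
    by (rule AE_eq_0_if_integral_lessThan[OF h])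
  then show ?thesis by eventually_elim (auto simp: h_def indicator_def)
qed

section \<open>Antiderivatives of test functions and weakly constant functions\<close>

lemma set_integrable_continuous:
  fixes f :: "real \<Rightarrow> complex"
  assumes "continuous_on UNIV f"
  shows "set_integrable lebesgue {0<..<a} f"
  using absolutely_integrable_continuous_real[OF continuous_on_subset[OF assms], of 0 a]
  by (simp add: absolutely_integrable_on_Icc_iff_Ioo)

lemma set_lebesgue_integral_continuous:
  fixes f :: "real \<Rightarrow> complex"
  assumes "continuous_on UNIV f"
  shows "(LINT x:{0<..<a}|lebesgue. f x) = integral {0..a} f"
  using set_lebesgue_integral_eq_integral(2)[OF set_integrable_continuous[OF assms]]
  by (simp add: integral_open_interval_real)

text \<open>The primitive starting at 0 vanishes to the left of the support of \<open>h\<close> and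
  is constant to its right; this constant is the total integral, which is 0.\<close>

lemma test_function_antiderivative:
  assumes h: "test_function a h" and "0 < a" and zero: "(LINT x:{0<..<a}|lebesgue. h x) = 0"
  obtains \<eta> where "test_function a \<eta>" "\<And>x. vector_derivative \<eta> (at x) = h x"
proof -
  obtain p q where pq: "0 < p" "p < q" "q < a" "\<And>x. x \<notin> {p..q} \<Longrightarrow> h x = 0"
    using test_function_support[OF h \<open>0 < a\<close>] by blast
  have cont: "continuous_on S h" for S
    by (rule test_function_vector_derivative(2)[OF h])
  have int: "h integrable_on {x..y}" for x y
    by (intro integrable_continuous_real cont)
  define \<eta> where "\<eta> x = integral {0..x} h" for x
  have left: "\<eta> x = 0" if "x < p" for x
  proof -
    have "integral {0..x} h = integral {0..x} (\<lambda>x. 0)"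
      using that pq(4) by (intro integral_cong) auto
    then show ?thesis by (simp add: \<eta>_def)
  qed
  have right: "\<eta> x = \<eta> q" if "x \<ge> q" for x
  proof -
    \<comment> \<open>The support bound says nothing about \<open>q\<close> itself, so this single
      point is removed as a null set.\<close>
    have "integral {q..x} h = integral {q..x} (\<lambda>x. 0)"
      using pq(4) by (intro integral_spike[of "{q}"]) auto
    then show ?thesis
      unfolding \<eta>_def using that pq Henstock_Kurzweil_Integration.integral_combine[of 0 q x h] int by simp
  qed
  have "\<eta> q = 0"
    using right[of a] pq zero set_lebesgue_integral_continuous[OF cont] by (simp add: \<eta>_def)
  have deriv: "(\<eta> has_vector_derivative h x) (at x)" for x
  proof (cases "x < p")
    case True
    have "((\<lambda>x. 0) has_vector_derivative 0) (at x)" by simp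
    then have "(\<eta> has_vector_derivative 0) (at x)"
      by (rule has_vector_derivative_transform_within_open[of _ _ _ "{..<p}"]) (use True left in auto)
    then show ?thesis using pq(4)[of x] True by simp
  next
    case False
    \<comment> \<open>The point x lies in the interior of \<open>{0..x + 1}\<close>, so the
      derivative within this interval is the two-sided one.\<close>
    have "(\<eta> has_vector_derivative h x) (at x within {0..x + 1})"
      unfolding \<eta>_def using False pq by (intro integral_has_vector_derivative cont) auto
    then show ?thesis
      using False pq at_within_interior[of x "{0..x + 1}"] by simp
  qed
  have "\<eta> C1_differentiable_on UNIV"
    unfolding C1_differentiable_on_def using deriv cont by blast
  then have "test_function a \<eta>"
    using pq left right \<open>\<eta> q = 0\<close> by (intro test_functionI[of _ p q]) auto
  moreover have "vector_derivative \<eta> (at x) = h x" for x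
    using deriv by (rule vector_derivative_at)
  ultimately show thesis by (rule that)
qed

text \<open>If every test function had integral 0, the constant 1 would vanish almost everywhere on
  an interval of positive length. Rescaling a test function with nonzero integral gives integral
  1.\<close>

lemma test_function_integral_1:
  assumes "0 < a"
  obtains \<psi> where "test_function a \<psi>" "(LINT x:{0<..<a}|lebesgue. \<psi> x) = 1"
proof -
  have "\<exists>\<phi>. test_function a \<phi> \<and> (LINT x:{0<..<a}|lebesgue. \<phi> x) \<noteq> 0"
  proof (rule ccontr)
    assume "\<not> ?thesis"
    then have "AE x in lebesgue. x \<in> {0<..<a} \<longrightarrow> (1::complex) = 0"
      by (intro AE_eq_0_if_test_functions set_integrable_continuous) auto
    then have "AE x in lebesgue. x \<notin> {0<..<a}" by simp
    then have "emeasure lebesgue {0<..<a} = 0"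
      by (subst (asm) AE_iff_measurable[of "{0<..<a}"]) auto
    then show False using assms by simp
  qed
  then obtain \<phi> where \<phi>: "test_function a \<phi>" "(LINT x:{0<..<a}|lebesgue. \<phi> x) \<noteq> 0" by blast
  show thesis
    using test_function_mult[OF \<phi>(1), of "\<lambda>x. inverse (LINT x:{0<..<a}|lebesgue. \<phi> x)"] \<phi>(2)
    by (intro that[of "\<lambda>x. \<phi> x * inverse (LINT x:{0<..<a}|lebesgue. \<phi> x)"]) auto
qed

lemma test_function_diff:
  assumes "test_function a \<phi>" "test_function a \<psi>"
  shows "test_function a (\<lambda>x. \<phi> x - \<psi> x)"
proof -
  have "closure {x. \<phi> x - \<psi> x \<noteq> 0} \<subseteq> closure ({x. \<phi> x \<noteq> 0} \<union> {x. \<psi> x \<noteq> 0})"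
    by (intro closure_mono) auto
  then show ?thesis
    using assms by (auto simp: test_function_def)
qed

text \<open>Subtracting from \<phi> a multiple of a fixed \<psi> with integral 1 leaves a function
  of mean 0, hence the derivative of a test function, against which \<open>w\<close> integrates to 0
  by hypothesis. Rearranged, \<open>w - c\<close> integrates to 0 against every \<phi>.\<close>

lemma du_Bois_Reymond:
  fixes w :: "real \<Rightarrow> complex"
  assumes w: "set_integrable lebesgue {0<..<a} w" and "0 < a"
    and zero: "\<And>\<phi>. test_function a \<phi> \<Longrightarrow>
        (LINT x:{0<..<a}|lebesgue. w x * vector_derivative \<phi> (at x)) = 0"
  obtains c where "AE x in lebesgue. x \<in> {0<..<a} \<longrightarrow> w x = c"
proof -
  obtain \<psi> where \<psi>: "test_function a \<psi>" "(LINT x:{0<..<a}|lebesgue. \<psi> x) = 1"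
    using test_function_integral_1[OF \<open>0 < a\<close>] by blast
  \<comment> \<open>Testing w = c against \<psi> forces this value, as \<psi> has integral
    1.\<close>
  define c where "c = (LINT x:{0<..<a}|lebesgue. w x * \<psi> x)"
  note cont = test_function_vector_derivative(2)
  have int1: "set_integrable lebesgue {0<..<a} \<phi>" if "test_function a \<phi>" for \<phi>
    using cont[OF that] by (rule set_integrable_continuous)
  have intw: "set_integrable lebesgue {0<..<a} (\<lambda>x. w x * \<phi> x)" if "test_function a \<phi>" for \<phi>
    using cont[OF that] by (intro set_integrable_mult_continuous w)
  have "AE x in lebesgue. x \<in> {0<..<a} \<longrightarrow> w x - c = 0"
  proof (rule AE_eq_0_if_test_functions)
    show "set_integrable lebesgue {0<..<a} (\<lambda>x. w x - c)"
      by (intro set_integral_diff w set_integrable_continuous) auto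
    fix \<phi> assume \<phi>: "test_function a \<phi>"
    define m where "m = (LINT x:{0<..<a}|lebesgue. \<phi> x)"
    have \<psi>m: "test_function a (\<lambda>x. \<psi> x * m)"
      by (rule test_function_mult[OF \<psi>(1)]) auto
    have h: "test_function a (\<lambda>x. \<phi> x - \<psi> x * m)"
      by (rule test_function_diff[OF \<phi> \<psi>m])
    have "(LINT x:{0<..<a}|lebesgue. \<phi> x - \<psi> x * m) = 0"
      using \<psi>(2) by (simp add: set_integral_diff int1 \<phi> \<psi>m m_def[symmetric])
    then obtain \<eta> where \<eta>: "test_function a \<eta>" "\<And>x. vector_derivative \<eta> (at x) = \<phi> x - \<psi> x * m"
      using test_function_antiderivative[OF h \<open>0 < a\<close>] by metis
    have "0 = (LINT x:{0<..<a}|lebesgue. w x * (\<phi> x - \<psi> x * m))"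
      using zero[OF \<eta>(1)] by (simp add: \<eta>(2))
    also have "\<dots> = (LINT x:{0<..<a}|lebesgue. w x * \<phi> x - (w x * \<psi> x) * m)"
      by (simp add: algebra_simps)
    also have "\<dots> = (LINT x:{0<..<a}|lebesgue. w x * \<phi> x) - c * m"
      using intw \<phi> \<psi>(1) by (simp add: set_integral_diff c_def)
    also have "\<dots> = (LINT x:{0<..<a}|lebesgue. w x * \<phi> x - c * \<phi> x)"
      using intw \<phi> int1 by (simp add: set_integral_diff m_def)
    finally show "(LINT x:{0<..<a}|lebesgue. (w x - c) * \<phi> x) = 0"
      by (simp add: algebra_simps)
  qed
  then show thesis by (intro that[of c]) simp
qed

section \<open>The weak equation v' = c v\<close>

lemma C1_differentiable_on_exp: "(\<lambda>x. exp (c * of_real x)) C1_differentiable_on S"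
  and vector_derivative_exp:
    "((\<lambda>x. exp (c * of_real x)) has_vector_derivative c * exp (c * of_real x)) (at x)"
  for c :: complex
proof -
  show d: "((\<lambda>x. exp (c * of_real x)) has_vector_derivative c * exp (c * of_real x)) (at x)" for x
  proof -
    have "((\<lambda>z. exp (c * z)) has_field_derivative c * exp (c * of_real x)) (at (of_real x))"
      by (auto intro!: derivative_eq_intros)
    then show ?thesis by (rule has_vector_derivative_real_field)
  qed
  show "(\<lambda>x. exp (c * of_real x)) C1_differentiable_on S"
    unfolding C1_differentiable_on_def using d
    by (intro exI[of _ "\<lambda>x. c * exp (c * of_real x)"]) (auto intro!: continuous_intros)
qed

lemma weak_exp_ode:
  fixes v :: "real \<Rightarrow> complex"
  assumes v: "set_integrable lebesgue {0<..<a} v" and "0 < a"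
    and weak: "\<And>\<phi>. test_function a \<phi> \<Longrightarrow>
        (LINT x:{0<..<a}|lebesgue. v x * vector_derivative \<phi> (at x))
        = - (c * (LINT x:{0<..<a}|lebesgue. v x * \<phi> x))"
  obtains C where "AE x in lebesgue. x \<in> {0<..<a} \<longrightarrow> v x = C * exp (c * of_real x)"
proof -
  define e where "e x = exp (- c * complex_of_real x)" for x
  have e: "e C1_differentiable_on UNIV" "continuous_on UNIV e"
    unfolding e_def by (rule C1_differentiable_on_exp, intro continuous_intros)
  have e': "(e has_vector_derivative - c * e x) (at x)" for x
    unfolding e_def by (rule vector_derivative_exp)
  have ve: "set_integrable lebesgue {0<..<a} (\<lambda>x. v x * e x)"
    by (rule set_integrable_mult_continuous[OF v e(2)])
  have "(LINT x:{0<..<a}|lebesgue. v x * e x * vector_derivative \<phi> (at x)) = 0"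
    if \<phi>: "test_function a \<phi>" for \<phi>
  proof -
    have d: "vector_derivative (\<lambda>x. \<phi> x * e x) (at x) = vector_derivative \<phi> (at x) * e x - c * (\<phi> x * e x)" for x
    proof -
      have "((\<lambda>x. \<phi> x * e x) has_vector_derivative
          (\<phi> x * (- c * e x) + vector_derivative \<phi> (at x) * e x)) (at x)"
        by (intro has_vector_derivative_mult test_function_vector_derivative(1)[OF \<phi>] e')
      then show ?thesis by (auto dest: vector_derivative_at simp: algebra_simps)
    qed
    have i1: "set_integrable lebesgue {0<..<a} (\<lambda>x. v x * e x * vector_derivative \<phi> (at x))"
      by (rule set_integrable_mult_continuous[OF ve test_function_vector_derivative(3)[OF \<phi>]])
    have i2: "set_integrable lebesgue {0<..<a} (\<lambda>x. v x * e x * \<phi> x)"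
      by (rule set_integrable_mult_continuous[OF ve test_function_vector_derivative(2)[OF \<phi>]])
    \<comment> \<open>The hypothesis is used with the test function \<phi> e; the summand - c \<phi>
      e of its derivative reproduces the left-hand side here and cancels it.\<close>
    have "- (c * (LINT x:{0<..<a}|lebesgue. v x * (\<phi> x * e x)))
      = (LINT x:{0<..<a}|lebesgue. v x * (vector_derivative \<phi> (at x) * e x - c * (\<phi> x * e x)))"
      using weak[OF test_function_mult[OF \<phi> e(1)]] by (simp add: d)
    also have "\<dots> = (LINT x:{0<..<a}|lebesgue. v x * e x * vector_derivative \<phi> (at x) - c * (v x * e x * \<phi> x))"
      by (simp add: algebra_simps)
    also have "\<dots> = (LINT x:{0<..<a}|lebesgue. v x * e x * vector_derivative \<phi> (at x))
        - c * (LINT x:{0<..<a}|lebesgue. v x * e x * \<phi> x)"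
      using i1 i2 by (simp add: set_integral_diff)
    finally show ?thesis by (simp add: mult.assoc mult.commute[of "\<phi> _"])
  qed
  from du_Bois_Reymond[OF ve \<open>0 < a\<close> this]
  obtain C where C: "AE x in lebesgue. x \<in> {0<..<a} \<longrightarrow> v x * e x = C" by blast
  have "v x = C * exp (c * of_real x)" if "v x * e x = C" for x
    using that unfolding e_def by (simp add: exp_minus field_simps)
  with C show thesis
    by (intro that[of C]) (auto elim!: eventually_mono)
qed


section \<open>Weak derivatives and point values of edge functions\<close>

lemma rep_abs_aefun: "AE x in lebesgue. rep_aefun (abs_aefun f) x = f x"
  by (rule Quotient3_rep_abs[OF Quotient3_aefun]) simp

lemma aefun_eq_iff: "u = v \<longleftrightarrow> (AE x in lebesgue. rep_aefun u x = rep_aefun v x)"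
  using Quotient3_rel_rep[OF Quotient3_aefun, of u v] by simp

lemma abs_rep_aefun: "abs_aefun (rep_aefun u) = u"
  by (rule Quotient3_abs_rep[OF Quotient3_aefun])

lemma rep_scale_aefun: "AE x in lebesgue. rep_aefun (scale_aefun c u) x = c * rep_aefun u x"
  using rep_abs_aefun[of "\<lambda>x. c * rep_aefun u x"] scale_aefun.abs_eq[of c "rep_aefun u"]
  by (simp add: abs_rep_aefun)

text \<open>On (0,a), which has finite measure, the modulus is at most 1 plus its square; elsewhere
  the function is 0 almost everywhere.\<close>

lemma L2_integrable:
  assumes "u \<in> L2 a"
  shows "integrable lebesgue (rep_aefun u)"
proof (rule Bochner_Integration.integrable_bound)
  show "integrable lebesgue (\<lambda>x. indicator {0<..<a} x + (cmod (rep_aefun u x))\<^sup>2)"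
    using assms emeasure_bounded_finite[of "{0<..<a}"]
    by (intro Bochner_Integration.integrable_add integrable_real_indicator) (auto simp: L2_def)
  show "rep_aefun u \<in> borel_measurable lebesgue" using assms by (simp add: L2_def)
  have "AE x in lebesgue. x \<notin> {0<..<a} \<longrightarrow> rep_aefun u x = 0" using assms by (simp add: L2_def)
  then show "AE x in lebesgue. norm (rep_aefun u x) \<le> norm (indicator {0<..<a} x + (cmod (rep_aefun u x))\<^sup>2)"
  proof eventually_elim
    case (elim x)
    show ?case
    proof (cases "x \<in> {0<..<a}")
      case True
      have "0 \<le> (cmod (rep_aefun u x) - 1)\<^sup>2 + (1 + (cmod (rep_aefun u x))\<^sup>2)"
        by (intro add_nonneg_nonneg) auto
      then have "cmod (rep_aefun u x) \<le> 1 + (cmod (rep_aefun u x))\<^sup>2"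
        unfolding power2_diff by simp
      then show ?thesis using True by simp
    qed (use elim in simp)
  qed
qed

lemma L2_set_integrable:
  assumes "u \<in> L2 a"
  shows "set_integrable lebesgue {0<..<a} (rep_aefun u)"
  using integrable_mult_indicator[OF _ L2_integrable[OF assms]] by (simp add: set_integrable_def)

lemma L2_eqI:
  assumes "u \<in> L2 a" "v \<in> L2 a"
    "AE x in lebesgue. x \<in> {0<..<a} \<longrightarrow> rep_aefun u x = rep_aefun v x"
  shows "u = v"
proof -
  have "AE x in lebesgue. x \<notin> {0<..<a} \<longrightarrow> rep_aefun u x = 0"
    "AE x in lebesgue. x \<notin> {0<..<a} \<longrightarrow> rep_aefun v x = 0"
    using assms by (auto simp: L2_def)
  with assms(3) show ?thesis
    unfolding aefun_eq_iff by eventually_elim auto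
qed

text \<open>Two weak derivatives have the same integrals against all test functions, so they agree
  almost everywhere on (0,a), and both vanish outside. This gives the definite description in
  \<open>weak_deriv\<close> its meaning.\<close>

lemma weak_deriv_eqI:
  assumes g: "g \<in> L2 a" "has_weak_deriv a u g"
  shows "weak_deriv a u = g"
  unfolding weak_deriv_def
proof (rule the_equality)
  show "g \<in> L2 a \<and> has_weak_deriv a u g" using g by simp
  fix h assume h: "h \<in> L2 a \<and> has_weak_deriv a u h"
  have "AE x in lebesgue. x \<in> {0<..<a} \<longrightarrow> rep_aefun h x - rep_aefun g x = 0"
  proof (rule AE_eq_0_if_test_functions)
    show "set_integrable lebesgue {0<..<a} (\<lambda>x. rep_aefun h x - rep_aefun g x)"
      using g h by (intro set_integral_diff L2_set_integrable) auto
    fix \<phi> assume \<phi>: "test_function a \<phi>"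
    have i: "set_integrable lebesgue {0<..<a} (\<lambda>x. rep_aefun v x * \<phi> x)" if "v \<in> L2 a" for v
      by (intro set_integrable_mult_continuous L2_set_integrable that test_function_vector_derivative(2)[OF \<phi>])
    have "(LINT x:{0<..<a}|lebesgue. rep_aefun h x * \<phi> x) = (LINT x:{0<..<a}|lebesgue. rep_aefun g x * \<phi> x)"
      using g h \<phi> unfolding has_weak_deriv_def by (metis neg_equal_iff_equal)
    then show "(LINT x:{0<..<a}|lebesgue. (rep_aefun h x - rep_aefun g x) * \<phi> x) = 0"
      using g h by (simp add: left_diff_distrib set_integral_diff i)
  qed
  then show "h = g"
    using g h by (intro L2_eqI[of h a g]) auto
qed

text \<open>Turns an equation between classes into one between integrals; for \<open>v = u\<close>
  it is the hypothesis of \<open>weak_exp_ode\<close>.\<close>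

lemma has_weak_deriv_scaleD:
  assumes "u \<in> L2 a" "has_weak_deriv a v (scale_aefun c u)" "test_function a \<phi>"
  shows "(LINT x:{0<..<a}|lebesgue. rep_aefun v x * vector_derivative \<phi> (at x))
    = - (c * (LINT x:{0<..<a}|lebesgue. rep_aefun u x * \<phi> x))"
proof -
  have m: "rep_aefun u \<in> borel_measurable lebesgue"
    using assms(1) by (simp add: L2_def)
  have m': "\<phi> \<in> borel_measurable lebesgue"
    using test_function_vector_derivative(2)[OF assms(3)]
    by (intro measurable_completion) (simp add: borel_measurable_continuous_onI)
  \<comment> \<open>The representative chosen for the scaled class is known only up to a null set;
    completeness of Lebesgue measure makes it measurable.\<close>
  have ms: "rep_aefun (scale_aefun c u) \<in> borel_measurable lebesgue"
  proof (rule borel_measurable_AE)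
    show "(\<lambda>x. c * rep_aefun u x) \<in> borel_measurable lebesgue"
      by (intro borel_measurable_times borel_measurable_const m)
    show "AE x in lebesgue. c * rep_aefun u x = rep_aefun (scale_aefun c u) x"
      using rep_scale_aefun[of c u] by (rule eventually_mono) simp
  qed
  have "(LINT x:{0<..<a}|lebesgue. rep_aefun (scale_aefun c u) x * \<phi> x)
      = (LINT x:{0<..<a}|lebesgue. c * (rep_aefun u x * \<phi> x))"
    using rep_scale_aefun[of c u]
    by (intro set_lebesgue_integral_cong_AE borel_measurable_times borel_measurable_const m m' ms)
       (auto elim!: eventually_mono)
  then show ?thesis
    using assms(2,3) by (simp add: has_weak_deriv_def)
qed

section \<open>Continuous functions as classes on an edge\<close>

text \<open>Extension by zero is what \<open>L2 a\<close> requires. The function \<open>f\<close>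
  lives on the whole line, so that continuity and derivatives at the end points need no one-sided
  versions.\<close>

definition edge_class :: "real \<Rightarrow> (real \<Rightarrow> complex) \<Rightarrow> aefun" where
  "edge_class a f = abs_aefun (\<lambda>x. if x \<in> {0<..<a} then f x else 0)"

lemma rep_edge_class: "AE x in lebesgue. rep_aefun (edge_class a f) x = (if x \<in> {0<..<a} then f x else 0)"
  unfolding edge_class_def by (rule rep_abs_aefun)

lemma edge_class_add: "edge_class a (\<lambda>x. f x + g x) = edge_class a f + edge_class a g"
  unfolding edge_class_def plus_aefun.abs_eq by (intro arg_cong[of _ _ abs_aefun]) auto

lemma edge_class_scale: "edge_class a (\<lambda>x. c * f x) = scale_aefun c (edge_class a f)"
  unfolding edge_class_def scale_aefun.abs_eq by (intro arg_cong[of _ _ abs_aefun]) auto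

lemma edge_class_in_L2:
  assumes "continuous_on UNIV f"
  shows "edge_class a f \<in> L2 a"
proof -
  let ?z = "\<lambda>x. if x \<in> {0<..<a} then f x else 0"
  have m: "rep_aefun (edge_class a f) \<in> borel_measurable lebesgue"
  proof (rule borel_measurable_AE)
    show "AE x in lebesgue. ?z x = rep_aefun (edge_class a f) x"
      using rep_edge_class[of a f] by (rule eventually_mono) simp
    have "f \<in> borel_measurable borel" using assms by (rule borel_measurable_continuous_onI)
    then have "?z \<in> borel_measurable borel" by measurable
    then show "?z \<in> borel_measurable lebesgue" by (intro measurable_completion) simp
  qed
  \<comment> \<open>The squared modulus is viewed as complex-valued because
    \<open>set_integrable_continuous\<close> is stated for complex functions.\<close>
  have "set_integrable lebesgue {0<..<a} (\<lambda>x. complex_of_real ((cmod (f x))\<^sup>2))"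
    by (intro set_integrable_continuous continuous_intros assms)
  then have "integrable lebesgue (\<lambda>x. complex_of_real ((cmod (?z x))\<^sup>2))"
    unfolding set_integrable_def
    by (rule Bochner_Integration.integrable_cong[THEN iffD1, rotated -1]) (auto simp: indicator_def)
  then have "integrable lebesgue (\<lambda>x. (cmod (?z x))\<^sup>2)"
    by (simp only: complex_of_real_integrable_eq)
  moreover have "(\<lambda>x. (cmod (?z x))\<^sup>2) \<in> borel_measurable lebesgue"
    using calculation by auto
  moreover have "AE x in lebesgue. (cmod (rep_aefun (edge_class a f) x))\<^sup>2 = (cmod (?z x))\<^sup>2"
    using rep_edge_class[of a f] by (rule eventually_mono) simp
  ultimately have "integrable lebesgue (\<lambda>x. (cmod (rep_aefun (edge_class a f) x))\<^sup>2)"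
    using m by (subst integrable_cong_AE[where g = "\<lambda>x. (cmod (?z x))\<^sup>2"]) auto
  then show ?thesis
    using m rep_edge_class[of a f] by (auto simp: L2_def elim!: eventually_mono)
qed

lemma edge_class_eqI:
  assumes "u \<in> L2 a" "AE x in lebesgue. x \<in> {0<..<a} \<longrightarrow> rep_aefun u x = f x"
  shows "u = edge_class a f"
proof -
  have "AE x in lebesgue. x \<notin> {0<..<a} \<longrightarrow> rep_aefun u x = 0"
    using assms by (auto simp: L2_def)
  with assms(2) rep_edge_class[of a f] show ?thesis
    unfolding aefun_eq_iff by eventually_elim auto
qed

text \<open>Integration by parts; the boundary terms vanish because the support of a test function
  avoids 0 and a.\<close>

lemma has_weak_deriv_edge_class:
  assumes "0 < a" and f: "\<And>x. (f has_vector_derivative f' x) (at x)" and f': "continuous_on UNIV f'"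
  shows "has_weak_deriv a (edge_class a f) (edge_class a f')"
  unfolding has_weak_deriv_def
proof (intro allI impI)
  fix \<phi> assume \<phi>: "test_function a \<phi>"
  let ?\<phi>' = "\<lambda>x. vector_derivative \<phi> (at x)"
  note cont = test_function_vector_derivative(2,3)[OF \<phi>]
  have cf: "continuous_on UNIV f"
    using f has_vector_derivative_continuous continuous_at_imp_continuous_on by blast
  have rep: "(LINT x:{0<..<a}|lebesgue. rep_aefun (edge_class a g) x * \<theta> x) = (LINT x:{0<..<a}|lebesgue. g x * \<theta> x)"
    if "continuous_on UNIV g" "continuous_on UNIV \<theta>" for g \<theta>
  proof (rule set_lebesgue_integral_cong_AE)
    have m: "h \<in> borel_measurable lebesgue" if "continuous_on UNIV h" for h :: "real \<Rightarrow> complex"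
      using that by (intro measurable_completion) (simp add: borel_measurable_continuous_onI)
    show "(\<lambda>x. rep_aefun (edge_class a g) x * \<theta> x) \<in> borel_measurable lebesgue"
    proof (rule borel_measurable_times)
      show "rep_aefun (edge_class a g) \<in> borel_measurable lebesgue"
        using edge_class_in_L2[OF that(1), of a] by (simp add: L2_def)
    qed (rule m[OF that(2)])
    show "(\<lambda>x. g x * \<theta> x) \<in> borel_measurable lebesgue"
      by (rule borel_measurable_times[OF m[OF that(1)] m[OF that(2)]])
    show "AE x\<in>{0<..<a} in lebesgue. rep_aefun (edge_class a g) x * \<theta> x = g x * \<theta> x"
      using rep_edge_class[of a g] by eventually_elim auto
  qed simp
  obtain p q where pq: "0 < p" "p < q" "q < a" "\<And>x. x \<notin> {p..q} \<Longrightarrow> \<phi> x = 0"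
    using test_function_support[OF \<phi> \<open>0 < a\<close>] by blast
  have c1: "continuous_on UNIV (\<lambda>x. f x * ?\<phi>' x)" and c2: "continuous_on UNIV (\<lambda>x. f' x * \<phi> x)"
    by (intro continuous_intros cf f' cont)+
  have "((\<lambda>x. f x * ?\<phi>' x + f' x * \<phi> x) has_integral f a * \<phi> a - f 0 * \<phi> 0) {0..a}"
    using \<open>0 < a\<close>
    by (intro fundamental_theorem_of_calculus has_vector_derivative_at_within[OF has_vector_derivative_mult]
        f test_function_vector_derivative(1)[OF \<phi>]) auto
  then have "integral {0..a} (\<lambda>x. f x * ?\<phi>' x + f' x * \<phi> x) = 0"
    using pq by (simp add: integral_unique)
  then have "(LINT x:{0<..<a}|lebesgue. f x * ?\<phi>' x + f' x * \<phi> x) = 0"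
    by (subst set_lebesgue_integral_continuous) (intro continuous_on_add c1 c2)
  then have "(LINT x:{0<..<a}|lebesgue. f x * ?\<phi>' x) + (LINT x:{0<..<a}|lebesgue. f' x * \<phi> x) = 0"
    by (subst (asm) set_integral_add) (intro set_integrable_continuous c1 c2)+
  then show "(LINT x:{0<..<a}|lebesgue. rep_aefun (edge_class a f) x * ?\<phi>' x)
      = - (LINT x:{0<..<a}|lebesgue. rep_aefun (edge_class a f') x * \<phi> x)"
    unfolding rep[OF cf cont(2)] rep[OF f' cont(1)] by (simp only: eq_neg_iff_add_eq_0)
qed

text \<open>The points of (0,a) where the functions differ form an open null set, which must be
  empty; continuity carries the equality to the end points.\<close>

lemma continuous_AE_eq:
  fixes f g :: "real \<Rightarrow> complex"
  assumes "continuous_on {0..a} f" "continuous_on {0..a} g" "0 < a"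
    and ae: "AE y in lebesgue. y \<in> {0<..<a} \<longrightarrow> f y = g y" and "x \<in> {0..a}"
  shows "f x = g x"
proof -
  have d: "continuous_on {0..a} (\<lambda>y. f y - g y)"
    by (intro continuous_intros assms)
  then have d': "continuous_on {0<..<a} (\<lambda>y. f y - g y)"
    by (rule continuous_on_subset) auto
  let ?S = "{y \<in> {0<..<a}. f y - g y \<noteq> 0}"
  have "open ((\<lambda>y. f y - g y) -` (- {0}) \<inter> {0<..<a})"
    using d' by (rule continuous_on_open_vimage[THEN iffD1, rule_format, rotated -2]) auto
  moreover have "(\<lambda>y. f y - g y) -` (- {0}) \<inter> {0<..<a} = ?S" by auto
  ultimately have op: "open ?S" by simp
  have "AE y in lebesgue. y \<notin> ?S"
    using ae by eventually_elim auto
  then have "negligible ?S"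
    using op by (simp add: negligible_iff_null_sets AE_iff_null_sets)
  then have "?S = {}"
    using op open_not_negligible by blast
  then have zero: "f y - g y = 0" if "y \<in> {0<..<a}" for y using that by blast
  have cl: "closure {0<..<a} = {0..a}" using \<open>0 < a\<close> by simp
  have "f x - g x = 0"
  proof (rule continuous_constant_on_closure[of "{0<..<a}" "\<lambda>y. f y - g y"])
    show "continuous_on (closure {0<..<a}) (\<lambda>y. f y - g y)" "x \<in> closure {0<..<a}"
      using d \<open>x \<in> {0..a}\<close> by (simp_all add: cl)
  qed (rule zero)
  then show ?thesis by simp
qed

text \<open>Every continuous representative coincides with \<open>f\<close> up to the end points, so
  \<open>f x\<close> is the only candidate for the definite description.\<close>

lemma point_value_edge_class:
  assumes "continuous_on UNIV f" "0 < a" "x \<in> {0..a}"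
  shows "point_value a (edge_class a f) x = f x"
  unfolding point_value_def
proof (rule the_equality)
  have c: "continuous_on {0..a} f" using assms(1) by (rule continuous_on_subset) simp
  have f: "AE y in lebesgue. y \<in> {0<..<a} \<longrightarrow> rep_aefun (edge_class a f) y = f y"
    using rep_edge_class[of a f] by eventually_elim auto
  show "\<exists>g. continuous_on {0..a} g
      \<and> (AE y in lebesgue. y \<in> {0<..<a} \<longrightarrow> rep_aefun (edge_class a f) y = g y) \<and> g x = f x"
    using c f by blast
  fix b
  assume "\<exists>g. continuous_on {0..a} g
      \<and> (AE y in lebesgue. y \<in> {0<..<a} \<longrightarrow> rep_aefun (edge_class a f) y = g y) \<and> g x = b"
  then obtain g where g: "continuous_on {0..a} g" "g x = b"
    "AE y in lebesgue. y \<in> {0<..<a} \<longrightarrow> rep_aefun (edge_class a f) y = g y" by blast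
  have "AE y in lebesgue. y \<in> {0<..<a} \<longrightarrow> f y = g y"
    using f g(3) by eventually_elim auto
  then show "b = f x"
    using continuous_AE_eq[OF c g(1) assms(2) _ assms(3)] g(2) by simp
qed


section \<open>Exponential solutions on one edge\<close>

text \<open>
  Diffusion edges use \<open>\<alpha> = \<i> k\<close>, transport edges use \<open>\<alpha> = k\<^sup>2\<close> and \<open>B = 0\<close>.
\<close>

definition exp_class :: "real \<Rightarrow> complex \<Rightarrow> complex \<Rightarrow> complex \<Rightarrow> aefun" where
  "exp_class a \<alpha> A B = edge_class a (\<lambda>x. A * exp (\<alpha> * of_real x) + B * exp (- \<alpha> * of_real x))"

lemma exp_class_continuous:
  "continuous_on S (\<lambda>x. A * exp (\<alpha> * of_real x) + B * exp (- \<alpha> * complex_of_real x))"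
  by (intro continuous_intros)

lemma exp_class_add: "exp_class a \<alpha> (A + A') (B + B') = exp_class a \<alpha> A B + exp_class a \<alpha> A' B'"
  unfolding exp_class_def edge_class_add[symmetric] by (simp add: algebra_simps)

lemma exp_class_scale: "exp_class a \<alpha> (c * A) (c * B) = scale_aefun c (exp_class a \<alpha> A B)"
  unfolding exp_class_def edge_class_scale[symmetric] by (simp add: algebra_simps)

lemma exp_class_in_L2: "exp_class a \<alpha> A B \<in> L2 a"
  unfolding exp_class_def by (intro edge_class_in_L2 exp_class_continuous)

lemma has_weak_deriv_exp_class:
  assumes "0 < a"
  shows "has_weak_deriv a (exp_class a \<alpha> A B) (exp_class a \<alpha> (\<alpha> * A) (- \<alpha> * B))"
  unfolding exp_class_def
proof (intro has_weak_deriv_edge_class assms exp_class_continuous)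
  fix x
  have "((\<lambda>x. A * exp (\<alpha> * of_real x) + B * exp (- \<alpha> * of_real x)) has_vector_derivative
      A * (\<alpha> * exp (\<alpha> * of_real x)) + B * (- \<alpha> * exp (- \<alpha> * of_real x))) (at x)"
    by (intro has_vector_derivative_add has_vector_derivative_mult_right vector_derivative_exp)
  then show "((\<lambda>x. A * exp (\<alpha> * of_real x) + B * exp (- \<alpha> * of_real x)) has_vector_derivative
      \<alpha> * A * exp (\<alpha> * of_real x) + - \<alpha> * B * exp (- \<alpha> * of_real x)) (at x)"
    by (simp add: algebra_simps)
qed

lemma weak_deriv_exp_class:
  assumes "0 < a"
  shows "weak_deriv a (exp_class a \<alpha> A B) = exp_class a \<alpha> (\<alpha> * A) (- \<alpha> * B)"
  using assms by (intro weak_deriv_eqI exp_class_in_L2 has_weak_deriv_exp_class)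

lemma exp_class_in_sobolev:
  assumes "0 < a"
  shows "exp_class a \<alpha> A B \<in> sobolev m a"
proof (induction m arbitrary: A B)
  case (Suc m)
  then show ?case
    using exp_class_in_L2 has_weak_deriv_exp_class[OF assms, of \<alpha> A B] unfolding sobolev.simps by blast
qed (simp add: exp_class_in_L2)

lemma point_value_exp_class:
  assumes "0 < a" "x \<in> {0..a}"
  shows "point_value a (exp_class a \<alpha> A B) x = A * exp (\<alpha> * of_real x) + B * exp (- \<alpha> * of_real x)"
  unfolding exp_class_def using assms by (intro point_value_edge_class exp_class_continuous)

text \<open>The values at 0 of the function and of its weak derivative give A + B = 0 and \<alpha>
  (A - B) = 0.\<close>

lemma exp_class_eq_0D:
  assumes "0 < a" "\<alpha> \<noteq> 0" "exp_class a \<alpha> A B = 0"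
  shows "A = 0" "B = 0"
proof -
  have 0: "exp_class a \<alpha> 0 0 = 0"
    using exp_class_add[of a \<alpha> 0 0 0 0] by simp
  have "A + B = 0"
    using point_value_exp_class[of a 0 \<alpha> A B] point_value_exp_class[of a 0 \<alpha> 0 0] assms 0 by simp
  moreover have "exp_class a \<alpha> (\<alpha> * A) (- \<alpha> * B) = 0"
    using weak_deriv_exp_class[of a \<alpha> A B] weak_deriv_exp_class[of a \<alpha> 0 0] assms 0 by simp
  then have "\<alpha> * A - \<alpha> * B = 0"
    using point_value_exp_class[of a 0 \<alpha> "\<alpha> * A" "- \<alpha> * B"] point_value_exp_class[of a 0 \<alpha> 0 0] assms 0 by simp
  ultimately show "A = 0" "B = 0"
    using \<open>\<alpha> \<noteq> 0\<close> by (auto simp: add_eq_0_iff)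
qed

lemma first_order_weak_ode:
  assumes "0 < a" "u \<in> L2 a" "has_weak_deriv a u (scale_aefun c u)"
  obtains A where "u = exp_class a c A 0"
proof -
  obtain A where "AE x in lebesgue. x \<in> {0<..<a} \<longrightarrow> rep_aefun u x = A * exp (c * of_real x)"
    using weak_exp_ode[OF L2_set_integrable[OF assms(2)] assms(1) has_weak_deriv_scaleD[OF assms(2,3)]] by blast
  then show thesis
    using assms(2) by (intro that[of A]) (simp add: exp_class_def edge_class_eqI)
qed

text \<open>If \<open>u' = g\<close> and \<open>g' = \<alpha>\<^sup>2 u\<close>, then \<open>v = g + \<beta> u\<close> solves \<open>v' = \<beta> v\<close> for \<open>\<beta> = \<plusminus>\<alpha>\<close>.\<close>

lemma second_order_weak_ode:
  assumes "0 < a" "\<alpha> \<noteq> 0" and u: "u \<in> L2 a" and g: "g \<in> L2 a"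
    and ug: "has_weak_deriv a u g" and gu: "has_weak_deriv a g (scale_aefun (\<alpha>\<^sup>2) u)"
  obtains A B where "u = exp_class a \<alpha> A B"
proof -
  \<comment> \<open>Both signs are treated at once, since the computation uses only that \<beta> and
    \<alpha> have the same square.\<close>
  have *: "\<exists>C. AE x in lebesgue. x \<in> {0<..<a} \<longrightarrow>
      rep_aefun g x + \<beta> * rep_aefun u x = C * exp (\<beta> * of_real x)" if \<beta>: "\<beta>\<^sup>2 = \<alpha>\<^sup>2" for \<beta>
  proof -
    have i: "set_integrable lebesgue {0<..<a} (\<lambda>x. rep_aefun v x * \<theta> x)"
      if "v \<in> L2 a" "continuous_on UNIV \<theta>" for v \<theta>
      by (intro set_integrable_mult_continuous L2_set_integrable that)
    have si: "set_integrable lebesgue {0<..<a} (\<lambda>x. rep_aefun g x + \<beta> * rep_aefun u x)"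
      by (intro set_integral_add set_integrable_mult_right L2_set_integrable u g)
    have lin: "(LINT x:{0<..<a}|lebesgue. (rep_aefun g x + \<beta> * rep_aefun u x) * \<theta> x)
      = (LINT x:{0<..<a}|lebesgue. rep_aefun g x * \<theta> x) + \<beta> * (LINT x:{0<..<a}|lebesgue. rep_aefun u x * \<theta> x)"
      if "continuous_on UNIV \<theta>" for \<theta>
    proof -
      have "(\<lambda>x. (rep_aefun g x + \<beta> * rep_aefun u x) * \<theta> x)
          = (\<lambda>x. rep_aefun g x * \<theta> x + \<beta> * (rep_aefun u x * \<theta> x))"
        by (simp add: algebra_simps)
      then show ?thesis
        using i[OF g that] i[OF u that] by (simp add: set_integral_add(2) set_integrable_mult_right)
    qed
    have "(LINT x:{0<..<a}|lebesgue. (rep_aefun g x + \<beta> * rep_aefun u x) * vector_derivative \<phi> (at x))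
        = - (\<beta> * (LINT x:{0<..<a}|lebesgue. (rep_aefun g x + \<beta> * rep_aefun u x) * \<phi> x))"
      if \<phi>: "test_function a \<phi>" for \<phi>
    proof -
      have "(LINT x:{0<..<a}|lebesgue. rep_aefun u x * vector_derivative \<phi> (at x))
          = - (LINT x:{0<..<a}|lebesgue. rep_aefun g x * \<phi> x)"
        using ug \<phi> by (simp add: has_weak_deriv_def)
      moreover have \<alpha>\<beta>: "\<alpha> * (\<alpha> * z) = \<beta> * (\<beta> * z)" for z
        using \<beta> by (metis mult.assoc power2_eq_square)
      ultimately show ?thesis
        unfolding lin[OF test_function_vector_derivative(2)[OF \<phi>]]
          lin[OF test_function_vector_derivative(3)[OF \<phi>]] has_weak_deriv_scaleD[OF u gu \<phi>]
        by (simp only: \<alpha>\<beta> power2_eq_square mult_minus_right minus_add_distrib distrib_left mult.assoc add.commute)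
    qed
    from weak_exp_ode[OF si \<open>0 < a\<close> this] show ?thesis by blast
  qed
  obtain C where C: "AE x in lebesgue. x \<in> {0<..<a} \<longrightarrow>
      rep_aefun g x + \<alpha> * rep_aefun u x = C * exp (\<alpha> * of_real x)"
    using *[of \<alpha>] by blast
  obtain D where D: "AE x in lebesgue. x \<in> {0<..<a} \<longrightarrow>
      rep_aefun g x + (- \<alpha>) * rep_aefun u x = D * exp (- \<alpha> * of_real x)"
    using *[of "- \<alpha>"] by auto
  \<comment> \<open>The difference of the two relations eliminates \<open>g\<close> and leaves 2
    \<alpha> u.\<close>
  have "AE x in lebesgue. x \<in> {0<..<a} \<longrightarrow> rep_aefun u x
      = (C / (2 * \<alpha>)) * exp (\<alpha> * of_real x) + (- D / (2 * \<alpha>)) * exp (- \<alpha> * of_real x)"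
    using C D
  proof eventually_elim
    case (elim x)
    show ?case
    proof
      assume x: "x \<in> {0<..<a}"
      let ?e = "exp (\<alpha> * of_real x)" and ?e' = "exp (- \<alpha> * of_real x)"
      have e: "rep_aefun g x + \<alpha> * rep_aefun u x = C * ?e" "rep_aefun g x + - \<alpha> * rep_aefun u x = D * ?e'"
        using elim x by blast+
      have "2 * \<alpha> * rep_aefun u x
          = (rep_aefun g x + \<alpha> * rep_aefun u x) - (rep_aefun g x + - \<alpha> * rep_aefun u x)"
        by simp
      then have "2 * \<alpha> * rep_aefun u x = C * ?e - D * ?e'"
        unfolding e .
      then have "rep_aefun u x = (C * ?e - D * ?e') / (2 * \<alpha>)"
        using \<open>\<alpha> \<noteq> 0\<close> by (metis mult_eq_0_iff nonzero_mult_div_cancel_left zero_neq_numeral)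
      then show "rep_aefun u x = (C / (2 * \<alpha>)) * ?e + (- D / (2 * \<alpha>)) * ?e'"
        by (simp add: diff_divide_distrib)
    qed
  qed
  from edge_class_eqI[OF u this] show thesis
    unfolding exp_class_def[symmetric] by (rule that)
qed


section \<open>Eigenfunctions on the graph\<close>

context vector_space
begin

text \<open>Links two notions of dimension: \<open>kernel_dim\<close>, for vectors in a carrier set,
  and \<open>dim\<close> of the type-based locale. The injective linear \<open>f\<close> maps a
  basis of the kernel to an independent set spanning the image.\<close>

lemma dim_image_mat_kernel:
  fixes f :: "'a Matrix.vec \<Rightarrow> 'b" and M :: "'a Matrix.mat"
  assumes M: "M \<in> carrier_mat m n"
    and add: "\<And>v w. v \<in> carrier_vec n \<Longrightarrow> w \<in> carrier_vec n \<Longrightarrow> f (v + w) = f v + f w"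
    and smult: "\<And>c v. v \<in> carrier_vec n \<Longrightarrow> f (c \<cdot>\<^sub>v v) = scale c (f v)"
    and inj: "inj_on f (carrier_vec n)"
  shows "\<exists>B. finite B \<and> f ` mat_kernel M \<subseteq> span B" "dim (f ` mat_kernel M) = kernel_dim M"
proof -
  interpret K: kernel m n M by unfold_locales (rule M)
  obtain B where B: "finite B" "K.basis B"
    using kernel_basis_exists[OF M] by blast
  have sub: "B \<subseteq> mat_kernel M" and indep: "K.lin_indpt B" and gen: "K.span B = mat_kernel M"
    using B(2) unfolding K.Ker.basis_def by auto
  have carrier: "mat_kernel M \<subseteq> carrier_vec n"
    by (rule mat_kernel_carrier[OF M])
  have f0: "f (0\<^sub>v n) = 0"
    using smult[of "0\<^sub>v n" 0] by simp
  \<comment> \<open>In coordinates, a combination over \<open>insert x S\<close> splits by the rules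
    for finite sums, which drives the induction below.\<close>
  have lincomb: "K.lincomb a S = Matrix.vec n (\<lambda>i. \<Sum>x\<in>S. a x * vec_index x i)"
    if S: "S \<subseteq> mat_kernel M" for a S
  proof (rule eq_vecI)
    have "K.lincomb a S \<in> mat_kernel M"
      using K.Ker.lincomb_closed[OF S] by simp
    then show "dim_vec (K.lincomb a S) = dim_vec (Matrix.vec n (\<lambda>i. \<Sum>x\<in>S. a x * vec_index x i))"
      using carrier by auto
  qed (use K.lincomb_index[OF _ S] in simp)
  have f_lincomb: "f (K.lincomb a S) = (\<Sum>x\<in>S. scale (a x) (f x))"
    if "finite S" "S \<subseteq> mat_kernel M" for a S
    using that
  proof (induction S)
    case empty
    have "Matrix.vec n (\<lambda>i. 0) = (0\<^sub>v n :: 'a Matrix.vec)" by auto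
    then show ?case using f0 by (simp add: lincomb[of "{}" a])
  next
    case (insert x S)
    then have x: "x \<in> carrier_vec n" using carrier by auto
    have "K.lincomb a (insert x S) = a x \<cdot>\<^sub>v x + K.lincomb a S"
      using insert x by (intro eq_vecI) (auto simp: lincomb[of "insert x S" a] lincomb[of S a])
    moreover have "K.lincomb a S \<in> carrier_vec n"
      using insert by (simp add: lincomb)
    ultimately show ?case using insert x by (simp add: add smult)
  qed
  have injB: "inj_on f B"
    using inj sub carrier by (meson inj_on_subset subset_trans)
  have indepB: "independent (f ` B)"
  proof
    assume "dependent (f ` B)"
    then obtain u y where u: "(\<Sum>y\<in>f ` B. scale (u y) y) = 0" "y \<in> f ` B" "u y \<noteq> 0"
      unfolding dependent_finite[OF finite_imageI[OF B(1)]] by blast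
    have "f (K.lincomb (u \<circ> f) B) = 0"
      using u(1) by (simp add: f_lincomb[OF B(1) sub] sum.reindex[OF injB])
    moreover have "K.lincomb (u \<circ> f) B \<in> carrier_vec n"
      by (simp add: lincomb[OF sub])
    ultimately have "K.lincomb (u \<circ> f) B = 0\<^sub>v n"
      by (intro inj_onD[OF inj]) (auto simp: f0)
    then have "K.lin_dep B"
      using u(2,3) B(1) unfolding K.Ker.lin_dep_def by fastforce
    then show False using indep by simp
  qed
  have spanB: "f ` mat_kernel M \<subseteq> span (f ` B)"
  proof
    fix y assume "y \<in> f ` mat_kernel M"
    then obtain v where v: "v \<in> K.span B" "y = f v" using gen by auto
    then obtain a S where S: "finite S" "S \<subseteq> B" "v = K.lincomb a S"
      unfolding K.Ker.span_def by auto
    then have "y = (\<Sum>x\<in>S. scale (a x) (f x))"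
      using v f_lincomb sub by auto
    then show "y \<in> span (f ` B)"
      using S(2) by (auto intro!: span_sum span_scale intro: span_base)
  qed
  then show "\<exists>B. finite B \<and> f ` mat_kernel M \<subseteq> span B" using B(1) by blast
  have "dim (f ` mat_kernel M) = card (f ` B)"
    using sub spanB indepB by (intro dim_unique[of "f ` B"]) auto
  also have "\<dots> = kernel_dim M"
    using K.Ker.dim_basis[OF B(1,2)] card_image[OF injB] by simp
  finally show "dim (f ` mat_kernel M) = kernel_dim M" .
qed

end

section \<open>Solutions on the graph parametrised by coefficient vectors\<close>

text \<open>The entries of \<open>v\<close> are ordered like the columns of X and Y: coefficients of
  exp (\<i> k x), then of exp (- \<i> k x) on the diffusion edges, then of exp (k^2 x) on the
  transport edges.\<close>

definition edge_solution :: "real list \<Rightarrow> real list \<Rightarrow> complex \<Rightarrow> complex Matrix.vec \<Rightarrow> edge_fun" where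
  "edge_solution a\<^sub>d a\<^sub>t k v =
    (\<lambda>i. if i < length a\<^sub>d
      then exp_class (a\<^sub>d ! i) (\<i> * k) (vec_index v i) (vec_index v (length a\<^sub>d + i)) else 0,
     \<lambda>j. if j < length a\<^sub>t
      then exp_class (a\<^sub>t ! j) (k\<^sup>2) (vec_index v (length a\<^sub>d + length a\<^sub>d + j)) 0 else 0)"

lemma exp_class_0: "exp_class a \<alpha> 0 0 = 0"
  using exp_class_add[of a \<alpha> 0 0 0 0] by simp

lemma scale_aefun_zero: "scale_aefun c 0 = 0"
  using exp_class_scale[of 0 0 c 0 0] by (simp add: exp_class_0)

lemma edge_solution_add:
  assumes "v \<in> carrier_vec (boundary_dim a\<^sub>d a\<^sub>t)" "w \<in> carrier_vec (boundary_dim a\<^sub>d a\<^sub>t)"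
  shows "edge_solution a\<^sub>d a\<^sub>t k (v + w) = edge_solution a\<^sub>d a\<^sub>t k v + edge_solution a\<^sub>d a\<^sub>t k w"
  using assms exp_class_add[of _ "k\<^sup>2" _ _ 0 0]
  by (auto simp: edge_solution_def boundary_dim_def fun_eq_iff exp_class_add)

lemma edge_solution_smult:
  assumes "v \<in> carrier_vec (boundary_dim a\<^sub>d a\<^sub>t)"
  shows "edge_solution a\<^sub>d a\<^sub>t k (c \<cdot>\<^sub>v v) = scale_edge_fun c (edge_solution a\<^sub>d a\<^sub>t k v)"
  using assms exp_class_scale[of _ "k\<^sup>2" c _ 0]
  by (auto simp: edge_solution_def boundary_dim_def scale_edge_fun_def fun_eq_iff exp_class_scale scale_aefun_zero)

text \<open>The kernel form of injectivity: \<open>k \<noteq> 0\<close> keeps the two exponentials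
  on each diffusion edge independent.\<close>

lemma edge_solution_eq_0D:
  assumes pos: "\<forall>a \<in> set a\<^sub>d. 0 < a" "\<forall>a \<in> set a\<^sub>t. 0 < a" and "k \<noteq> 0"
    and v: "v \<in> carrier_vec (boundary_dim a\<^sub>d a\<^sub>t)" and zero: "edge_solution a\<^sub>d a\<^sub>t k v = 0"
  shows "v = 0\<^sub>v (boundary_dim a\<^sub>d a\<^sub>t)"
proof (rule eq_vecI)
  let ?d = "length a\<^sub>d" and ?t = "length a\<^sub>t"
  have d: "vec_index v i = 0" "vec_index v (?d + i) = 0" if "i < ?d" for i
  proof -
    have "fst (edge_solution a\<^sub>d a\<^sub>t k v) i = 0" by (simp add: zero)
    then have "exp_class (a\<^sub>d ! i) (\<i> * k) (vec_index v i) (vec_index v (?d + i)) = 0"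
      using that by (simp add: edge_solution_def)
    then show "vec_index v i = 0" "vec_index v (?d + i) = 0"
      using exp_class_eq_0D[of "a\<^sub>d ! i" "\<i> * k"] pos that \<open>k \<noteq> 0\<close> by auto
  qed
  have t: "vec_index v (?d + ?d + j) = 0" if "j < ?t" for j
  proof -
    have "snd (edge_solution a\<^sub>d a\<^sub>t k v) j = 0" by (simp add: zero)
    then have "exp_class (a\<^sub>t ! j) (k\<^sup>2) (vec_index v (?d + ?d + j)) 0 = 0"
      using that by (simp add: edge_solution_def)
    then show ?thesis
      using exp_class_eq_0D(1)[of "a\<^sub>t ! j" "k\<^sup>2"] pos that \<open>k \<noteq> 0\<close> by auto
  qed
  fix i assume "i < dim_vec (0\<^sub>v (boundary_dim a\<^sub>d a\<^sub>t) :: complex Matrix.vec)"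
  then have i: "i < ?d + ?d + ?t" by (simp add: boundary_dim_def)
  then consider "i < ?d" | "?d \<le> i" "i < ?d + ?d" | "?d + ?d \<le> i" by linarith
  then have "vec_index v i = 0"
  proof cases
    case 2 then show ?thesis using d(2)[of "i - ?d"] by simp
  next
    case 3 then show ?thesis using t[of "i - (?d + ?d)"] i by simp
  qed (rule d)
  then show "vec_index v i = vec_index (0\<^sub>v (boundary_dim a\<^sub>d a\<^sub>t)) i"
    using i by (simp add: boundary_dim_def)
qed (use v in auto)

lemma edge_solution_in_edge_sobolev:
  assumes "\<forall>a \<in> set a\<^sub>d. 0 < a" "\<forall>a \<in> set a\<^sub>t. 0 < a"
  shows "edge_solution a\<^sub>d a\<^sub>t k v \<in> edge_sobolev a\<^sub>d a\<^sub>t"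
  using assms by (auto simp: edge_solution_def edge_sobolev_def simp del: sobolev.simps intro!: exp_class_in_sobolev)

text \<open>Two derivatives on a diffusion edge multiply by (\<i> k)^2 = - k^2; the negative of one
  derivative on a transport edge multiplies by - k^2 as well.\<close>

lemma graph_op_edge_solution:
  assumes "\<forall>a \<in> set a\<^sub>d. 0 < a" "\<forall>a \<in> set a\<^sub>t. 0 < a"
  shows "graph_op a\<^sub>d a\<^sub>t (edge_solution a\<^sub>d a\<^sub>t k v) = scale_edge_fun (- k\<^sup>2) (edge_solution a\<^sub>d a\<^sub>t k v)"
proof -
  have "weak_deriv a (weak_deriv a (exp_class a (\<i> * k) A B)) = scale_aefun (- k\<^sup>2) (exp_class a (\<i> * k) A B)"
    if "0 < a" for a A B
    unfolding weak_deriv_exp_class[OF that] exp_class_scale[symmetric]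
    by (simp add: power2_eq_square algebra_simps)
  moreover have "- weak_deriv a (exp_class a (k\<^sup>2) A 0) = scale_aefun (- k\<^sup>2) (exp_class a (k\<^sup>2) A 0)"
    if "0 < a" for a A
  proof -
    \<comment> \<open>Negation is recognised as the additive inverse: the coefficients of the two
      classes add up to 0.\<close>
    have "exp_class a (k\<^sup>2) (k\<^sup>2 * A) 0 + exp_class a (k\<^sup>2) (- k\<^sup>2 * A) (- k\<^sup>2 * 0) = 0"
      unfolding exp_class_add[symmetric] by (simp add: exp_class_0)
    then show ?thesis
      unfolding weak_deriv_exp_class[OF that] exp_class_scale[symmetric]
      by (simp add: minus_unique)
  qed
  ultimately show ?thesis
    using assms
    by (auto simp: graph_op_def edge_solution_def scale_edge_fun_def fun_eq_iff scale_aefun_zero)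
qed

text \<open>By uniqueness, the derivative whose existence \<open>sobolev\<close> asserts is the one
  named by \<open>weak_deriv\<close>.\<close>

lemma sobolev_weak_deriv:
  assumes "u \<in> sobolev (Suc m) a"
  shows "weak_deriv a u \<in> sobolev m a" "has_weak_deriv a u (weak_deriv a u)"
proof -
  obtain g where g: "g \<in> sobolev m a" "has_weak_deriv a u g"
    using assms by auto
  have "sobolev m a \<subseteq> L2 a" by (cases m) auto
  then have "weak_deriv a u = g"
    using g by (intro weak_deriv_eqI) auto
  then show "weak_deriv a u \<in> sobolev m a" "has_weak_deriv a u (weak_deriv a u)"
    using g by auto
qed

text \<open>The parametrisation reaches every solution: the eigenvalue equation splits into one weak
  differential equation per edge, and the constants of the separate solutions are collected in one
  vector.\<close>

lemma edge_solution_exists: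
  assumes pos: "\<forall>a \<in> set a\<^sub>d. 0 < a" "\<forall>a \<in> set a\<^sub>t. 0 < a" and "k \<noteq> 0"
    and u: "u \<in> edge_sobolev a\<^sub>d a\<^sub>t" and eig: "graph_op a\<^sub>d a\<^sub>t u = scale_edge_fun (- k\<^sup>2) u"
  obtains v where "v \<in> carrier_vec (boundary_dim a\<^sub>d a\<^sub>t)" "u = edge_solution a\<^sub>d a\<^sub>t k v"
proof -
  let ?d = "length a\<^sub>d" and ?t = "length a\<^sub>t"
  obtain ud ut where [simp]: "u = (ud, ut)" by (cases u)
  have "\<exists>A B. ud i = exp_class (a\<^sub>d ! i) (\<i> * k) A B" if i: "i < ?d" for i
  proof -
    let ?a = "a\<^sub>d ! i"
    have S: "ud i \<in> sobolev (Suc (Suc 0)) ?a"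
      using u i by (simp add: edge_sobolev_def numeral_2_eq_2)
    have "fst (graph_op a\<^sub>d a\<^sub>t u) i = fst (scale_edge_fun (- k\<^sup>2) u) i" by (simp only: eig)
    \<comment> \<open>The factor - k^2 is written as (\<i> k)^2, the form
      \<open>second_order_weak_ode\<close> takes for \<alpha> = \<i> k.\<close>
    then have eq: "weak_deriv ?a (weak_deriv ?a (ud i)) = scale_aefun ((\<i> * k)\<^sup>2) (ud i)"
      using i by (simp add: graph_op_def scale_edge_fun_def power_mult_distrib)
    have "ud i \<in> L2 ?a" "weak_deriv ?a (ud i) \<in> L2 ?a"
      using S sobolev_weak_deriv(1)[OF S] by auto
    moreover note sobolev_weak_deriv(2)[OF S]
    moreover have "has_weak_deriv ?a (weak_deriv ?a (ud i)) (scale_aefun ((\<i> * k)\<^sup>2) (ud i))"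
      using sobolev_weak_deriv(2)[OF sobolev_weak_deriv(1)[OF S]] unfolding eq .
    ultimately show ?thesis
      using second_order_weak_ode[of ?a "\<i> * k" "ud i" "weak_deriv ?a (ud i)"] pos i \<open>k \<noteq> 0\<close>
      by (metis complex_i_not_zero mult_eq_0_iff nth_mem)
  qed
  then obtain A B where AB: "\<And>i. i < ?d \<Longrightarrow> ud i = exp_class (a\<^sub>d ! i) (\<i> * k) (A i) (B i)"
    by metis
  have "\<exists>C. ut j = exp_class (a\<^sub>t ! j) (k\<^sup>2) C 0" if j: "j < ?t" for j
  proof -
    let ?a = "a\<^sub>t ! j"
    have S: "ut j \<in> sobolev (Suc 0) ?a"
      using u j by (simp add: edge_sobolev_def)
    have "snd (graph_op a\<^sub>d a\<^sub>t u) j = snd (scale_edge_fun (- k\<^sup>2) u) j" by (simp only: eig)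
    then have "- weak_deriv ?a (ut j) = scale_aefun (- k\<^sup>2) (ut j)"
      using j by (simp add: graph_op_def scale_edge_fun_def)
    \<comment> \<open>Scaling by - k^2 is the negative of scaling by k^2, so the two minus signs
      cancel.\<close>
    moreover have "scale_aefun (- k\<^sup>2) (ut j) + scale_aefun (k\<^sup>2) (ut j) = 0"
      unfolding scale_aefun_simps(2)[symmetric] using scale_aefun_simps(2)[of 0 0 "ut j"] by simp
    ultimately have eq: "weak_deriv ?a (ut j) = scale_aefun (k\<^sup>2) (ut j)"
      by (metis add.inverse_inverse minus_unique)
    have "ut j \<in> L2 ?a" using S by simp
    moreover have "has_weak_deriv ?a (ut j) (scale_aefun (k\<^sup>2) (ut j))"
      using sobolev_weak_deriv(2)[OF S] unfolding eq .
    ultimately show ?thesis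
      using first_order_weak_ode[of ?a "ut j" "k\<^sup>2"] pos j by (metis nth_mem)
  qed
  then obtain C where C: "\<And>j. j < ?t \<Longrightarrow> ut j = exp_class (a\<^sub>t ! j) (k\<^sup>2) (C j) 0"
    by metis
  define v where "v = Matrix.vec (boundary_dim a\<^sub>d a\<^sub>t)
    (\<lambda>i. if i < ?d then A i else if i < ?d + ?d then B (i - ?d) else C (i - (?d + ?d)))"
  have "ud i = 0" if "\<not> i < ?d" for i using u that by (simp add: edge_sobolev_def)
  moreover have "ut j = 0" if "\<not> j < ?t" for j using u that by (simp add: edge_sobolev_def)
  ultimately have "u = edge_solution a\<^sub>d a\<^sub>t k v"
    by (auto simp: edge_solution_def v_def boundary_dim_def fun_eq_iff AB C)
  then show thesis by (intro that[of v]) (auto simp: v_def)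
qed

section \<open>Boundary data of solutions through the block matrices\<close>

lemma mat_diag_mult_vec:
  assumes "v \<in> carrier_vec n"
  shows "mat_diag n f *\<^sub>v v = Matrix.vec n (\<lambda>i. f i * (vec_index v i :: 'a :: comm_ring_1))"
proof (rule eq_vecI)
  fix i assume "i < dim_vec (Matrix.vec n (\<lambda>i. f i * vec_index v i))"
  then have i: "i < n" by simp
  have "vec_index (mat_diag n f *\<^sub>v v) i = (\<Sum>j\<in>{0..<n}. (if i = j then f j else 0) * vec_index v j)"
    using assms i by (simp add: mat_diag_def scalar_prod_def)
  also have "\<dots> = (\<Sum>j\<in>{0..<n}. if i = j then f j * vec_index v j else 0)"
    by (intro sum.cong) auto
  finally show "vec_index (mat_diag n f *\<^sub>v v) i = vec_index (Matrix.vec n (\<lambda>i. f i * vec_index v i)) i"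
    using i by simp
qed (simp add: mat_diag_def)

lemma exp_diag_carrier: "exp_diag z a \<in> carrier_mat (length a) (length a)"
  by (simp add: exp_diag_def mat_diag_def)

lemma X_mat_carrier: "X_mat a\<^sub>d a\<^sub>t k \<in> carrier_mat (boundary_dim a\<^sub>d a\<^sub>t) (boundary_dim a\<^sub>d a\<^sub>t)"
  and Y_mat_carrier: "Y_mat a\<^sub>d a\<^sub>t k \<in> carrier_mat (boundary_dim a\<^sub>d a\<^sub>t) (boundary_dim a\<^sub>d a\<^sub>t)"
  unfolding X_mat_def Y_mat_def boundary_dim_def Let_def
  by (intro four_block_carrier_mat smult_carrier_mat add_carrier_mat minus_carrier_mat exp_diag_carrier one_carrier_mat)+

lemma split_boundary_vec:
  assumes "v \<in> carrier_vec (boundary_dim a\<^sub>d a\<^sub>t)"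
  obtains \<alpha> \<beta> \<gamma> where "v = (\<alpha> @\<^sub>v \<beta>) @\<^sub>v \<gamma>" "\<alpha> \<in> carrier_vec (length a\<^sub>d)" "\<beta> \<in> carrier_vec (length a\<^sub>d)"
    "\<gamma> \<in> carrier_vec (length a\<^sub>t)"
proof
  let ?d = "length a\<^sub>d" and ?t = "length a\<^sub>t"
  let ?\<alpha> = "Matrix.vec ?d (vec_index v)" and ?\<beta> = "Matrix.vec ?d (\<lambda>i. vec_index v (?d + i))"
    and ?\<gamma> = "Matrix.vec ?t (\<lambda>i. vec_index v (?d + ?d + i))"
  show "v = (?\<alpha> @\<^sub>v ?\<beta>) @\<^sub>v ?\<gamma>"
    using assms by (intro eq_vecI) (auto simp: boundary_dim_def)
qed auto

lemma zero_mat_mult_vec: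
  assumes "v \<in> carrier_vec n"
  shows "0\<^sub>m m n *\<^sub>v v = (0\<^sub>v m :: 'a :: comm_ring_1 Matrix.vec)"
  using assms by (intro eq_vecI) auto

text \<open>Rewrites the blocks of X and Y other than the zero ones as single
  \<open>mat_diag\<close> terms, the shape needed by
  \<open>mat_diag_blocks_mult_vec\<close>.\<close>

lemma mat_diag_arith:
  "1\<^sub>m n = mat_diag n (\<lambda>i. 1 :: 'a :: comm_ring_1)"
  "c \<cdot>\<^sub>m mat_diag n f = mat_diag n (\<lambda>i. c * f i :: 'a)"
  "mat_diag n f + mat_diag n g = mat_diag n (\<lambda>i. f i + g i :: 'a)"
  "mat_diag n f - mat_diag n g = mat_diag n (\<lambda>i. f i - g i :: 'a)"
  by (intro eq_matI; auto simp: mat_diag_def)+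

lemma mat_diag_blocks_mult_vec:
  assumes "\<alpha> \<in> carrier_vec d" "\<beta> \<in> carrier_vec d" "\<gamma> \<in> carrier_vec t"
  shows "four_block_mat
      (four_block_mat (mat_diag d f\<^sub>1) (mat_diag d f\<^sub>2) (mat_diag d f\<^sub>3) (mat_diag d f\<^sub>4))
      (0\<^sub>m (d + d) t) (0\<^sub>m t (d + d)) (mat_diag t g) *\<^sub>v ((\<alpha> @\<^sub>v \<beta>) @\<^sub>v \<gamma>)
    = Matrix.vec d (\<lambda>i. f\<^sub>1 i * vec_index \<alpha> i + f\<^sub>2 i * vec_index \<beta> i) @\<^sub>v
      Matrix.vec d (\<lambda>i. f\<^sub>3 i * vec_index \<alpha> i + f\<^sub>4 i * vec_index \<beta> i) @\<^sub>v
      Matrix.vec t (\<lambda>i. g i * (vec_index \<gamma> i :: 'a :: comm_ring_1))"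
proof -
  have D: "mat_diag n f \<in> carrier_mat n n" for n and f :: "nat \<Rightarrow> 'a"
    by (simp add: mat_diag_def)
  have blk: "four_block_mat (mat_diag d f\<^sub>1) (mat_diag d f\<^sub>2) (mat_diag d f\<^sub>3) (mat_diag d f\<^sub>4)
      \<in> carrier_mat (d + d) (d + d)"
    by (intro four_block_carrier_mat D)
  have \<alpha>\<beta>: "\<alpha> @\<^sub>v \<beta> \<in> carrier_vec (d + d)" using assms by simp
  show ?thesis
    unfolding four_block_mat_mult_vec[OF blk zero_carrier_mat zero_carrier_mat D \<alpha>\<beta> assms(3)]
      four_block_mat_mult_vec[OF D D D D assms(1,2)]
      mat_diag_mult_vec[OF assms(1)] mat_diag_mult_vec[OF assms(2)] mat_diag_mult_vec[OF assms(3)]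
      zero_mat_mult_vec[OF \<alpha>\<beta>] zero_mat_mult_vec[OF assms(3)]
    \<comment> \<open>What remains is to drop the zero blocks and to reassociate the concatenation
      to the right, as in \<open>boundary_values\<close>.\<close>
    by (intro eq_vecI) auto
qed

text \<open>X and Y collect the boundary data of the exponentials: end point values and outward
  derivatives on diffusion edges. On a transport edge the values at 0 and a are \<gamma> and exp
  (k^2 a) \<gamma>, combined as sum and difference.\<close>

lemma boundary_edge_solution:
  assumes pos: "\<forall>a \<in> set a\<^sub>d. 0 < a" "\<forall>a \<in> set a\<^sub>t. 0 < a"
    and v: "v \<in> carrier_vec (boundary_dim a\<^sub>d a\<^sub>t)"
  shows "boundary_values a\<^sub>d a\<^sub>t (edge_solution a\<^sub>d a\<^sub>t k v) = X_mat a\<^sub>d a\<^sub>t k *\<^sub>v v" (is ?val)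
    and "boundary_derivs a\<^sub>d a\<^sub>t (edge_solution a\<^sub>d a\<^sub>t k v) = Y_mat a\<^sub>d a\<^sub>t k *\<^sub>v v" (is ?der)
proof -
  let ?d = "length a\<^sub>d" and ?t = "length a\<^sub>t"
  obtain \<alpha> \<beta> \<gamma> where veq: "v = (\<alpha> @\<^sub>v \<beta>) @\<^sub>v \<gamma>"
    and c: "\<alpha> \<in> carrier_vec ?d" "\<beta> \<in> carrier_vec ?d" "\<gamma> \<in> carrier_vec ?t"
    using split_boundary_vec[OF v] by blast
  have idx: "vec_index v i = vec_index \<alpha> i" "vec_index v (?d + i) = vec_index \<beta> i" if "i < ?d" for i
    using that c by (auto simp: veq)
  have idx_t: "vec_index v (?d + ?d + j) = vec_index \<gamma> j" if "j < ?t" for j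
    using that c by (auto simp: veq)
  have pos': "0 < a\<^sub>d ! i" if "i < ?d" for i using pos(1) that by simp
  have pos_t: "0 < a\<^sub>t ! j" if "j < ?t" for j using pos(2) that by simp
  show ?val
    unfolding X_mat_def Let_def exp_diag_def mat_diag_arith veq mat_diag_blocks_mult_vec[OF c]
    unfolding veq[symmetric] boundary_values_def edge_solution_def prod.case
    by (intro arg_cong2[of _ _ _ _ "(@\<^sub>v)"] eq_vecI;
        (simp add: point_value_exp_class pos' pos_t less_imp_le idx idx_t)?; (simp add: algebra_simps)?)
  show ?der
    unfolding Y_mat_def Let_def exp_diag_def mat_diag_arith veq mat_diag_blocks_mult_vec[OF c]
    unfolding veq[symmetric] boundary_derivs_def edge_solution_def prod.case
    by (intro arg_cong2[of _ _ _ _ "(@\<^sub>v)"] eq_vecI;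
        (simp add: weak_deriv_exp_class point_value_exp_class pos' pos_t less_imp_le idx idx_t)?;
        (simp add: algebra_simps)?)
qed

section \<open>The eigenspace as an injective linear image of the kernel\<close>

theorem proposition6p2:
  fixes a\<^sub>d a\<^sub>t :: "real list" and P L :: "complex Matrix.mat" and k :: complex
  assumes "\<forall>a \<in> set a\<^sub>d. 0 < a" and "\<forall>a \<in> set a\<^sub>t. 0 < a"
    and "orthogonal_projector (boundary_dim a\<^sub>d a\<^sub>t) P"
    and "acts_in_kernel (boundary_dim a\<^sub>d a\<^sub>t) P L"
    and "k \<noteq> 0"
  shows "(is_eigenvalue (graph_op_domain a\<^sub>d a\<^sub>t P L) (graph_op a\<^sub>d a\<^sub>t) (- k\<^sup>2) \<longleftrightarrow>
            mat_kernel (Z_mat a\<^sub>d a\<^sub>t P L k) \<noteq> {0\<^sub>v (boundary_dim a\<^sub>d a\<^sub>t)})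
       \<and> has_geometric_multiplicity (graph_op_domain a\<^sub>d a\<^sub>t P L) (graph_op a\<^sub>d a\<^sub>t) (- k\<^sup>2)
            (kernel_dim (Z_mat a\<^sub>d a\<^sub>t P L k))"
proof -
  let ?n = "boundary_dim a\<^sub>d a\<^sub>t" and ?Z = "Z_mat a\<^sub>d a\<^sub>t P L k"
  let ?X = "X_mat a\<^sub>d a\<^sub>t k" and ?Y = "Y_mat a\<^sub>d a\<^sub>t k"
  let ?f = "edge_solution a\<^sub>d a\<^sub>t k"
  let ?E = "eigenspace (graph_op_domain a\<^sub>d a\<^sub>t P L) (graph_op a\<^sub>d a\<^sub>t) (- k\<^sup>2)"
  note pos = assms(1,2)
  have P: "P \<in> carrier_mat ?n ?n" and L: "L \<in> carrier_mat ?n ?n"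
    using assms(3,4) by (auto simp: orthogonal_projector_def acts_in_kernel_def)
  have perp: "perp ?n P \<in> carrier_mat ?n ?n"
    using P by (simp add: perp_def minus_carrier_mat)
  note X = X_mat_carrier[of a\<^sub>d a\<^sub>t k] and Y = Y_mat_carrier[of a\<^sub>d a\<^sub>t k]
  have PL: "P + L \<in> carrier_mat ?n ?n" using L by simp
  have Z: "?Z \<in> carrier_mat ?n ?n"
    unfolding Z_mat_def using perp Y by (intro add_carrier_mat mult_carrier_mat)
  \<comment> \<open>In terms of coefficients, the boundary condition becomes membership in the
    kernel of Z.\<close>
  have Zv: "perp ?n P *\<^sub>v (?Y *\<^sub>v v) + (L + P) *\<^sub>v (?X *\<^sub>v v) = ?Z *\<^sub>v v" if v: "v \<in> carrier_vec ?n" for v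
  proof -
    have "?Z *\<^sub>v v = (P + L) *\<^sub>v (?X *\<^sub>v v) + perp ?n P *\<^sub>v (?Y *\<^sub>v v)"
      unfolding Z_mat_def add_mult_distrib_mat_vec[OF mult_carrier_mat[OF PL X] mult_carrier_mat[OF perp Y] v]
        assoc_mult_mat_vec[OF PL X v] assoc_mult_mat_vec[OF perp Y v] ..
    also have "P + L = L + P" using P L by (rule comm_add_mat)
    also have "(L + P) *\<^sub>v (?X *\<^sub>v v) + perp ?n P *\<^sub>v (?Y *\<^sub>v v)
        = perp ?n P *\<^sub>v (?Y *\<^sub>v v) + (L + P) *\<^sub>v (?X *\<^sub>v v)"
      using P L perp X Y v by (intro comm_add_vec[of _ ?n] mult_mat_vec_carrier[of _ ?n ?n]) auto
    finally show ?thesis ..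
  qed
  have dom: "?f v \<in> graph_op_domain a\<^sub>d a\<^sub>t P L \<longleftrightarrow> v \<in> mat_kernel ?Z" if v: "v \<in> carrier_vec ?n" for v
    using v edge_solution_in_edge_sobolev[OF pos] Zv[OF v]
    by (simp add: graph_op_domain_def boundary_edge_solution[OF pos v] mat_kernel[OF Z])
  \<comment> \<open>One inclusion rests on the existence of coefficients, the other on the
    eigenvalue equation for exponentials; \<open>dom\<close> translates the boundary condition in
    both.\<close>
  have E: "?E = ?f ` mat_kernel ?Z"
  proof (intro subset_antisym subsetI)
    fix u assume "u \<in> ?E"
    then have u: "u \<in> graph_op_domain a\<^sub>d a\<^sub>t P L" "graph_op a\<^sub>d a\<^sub>t u = scale_edge_fun (- k\<^sup>2) u"
      by (auto simp only: eigenspace_def mem_Collect_eq)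
    then have "u \<in> edge_sobolev a\<^sub>d a\<^sub>t" by (simp add: graph_op_domain_def)
    then obtain v where "v \<in> carrier_vec ?n" "u = ?f v"
      using edge_solution_exists[OF pos \<open>k \<noteq> 0\<close> _ u(2)] by blast
    then show "u \<in> ?f ` mat_kernel ?Z" using dom u(1) by blast
  next
    fix u assume "u \<in> ?f ` mat_kernel ?Z"
    then obtain v where v: "v \<in> mat_kernel ?Z" "u = ?f v" by blast
    then have "u \<in> graph_op_domain a\<^sub>d a\<^sub>t P L"
      using dom mat_kernelD(1)[OF Z] by blast
    then show "u \<in> ?E"
      using graph_op_edge_solution[OF pos] v(2) by (simp only: eigenspace_def mem_Collect_eq)
  qed
  have "0 \<cdot>\<^sub>v 0\<^sub>v ?n = (0\<^sub>v ?n :: complex Matrix.vec)" by (intro eq_vecI) auto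
  then have zero: "?f (0\<^sub>v ?n) = 0"
    using edge_solution_smult[of "0\<^sub>v ?n" a\<^sub>d a\<^sub>t k 0] by simp
  have inj: "inj_on ?f (carrier_vec ?n)"
  proof (rule inj_onI)
    fix v w assume vw: "v \<in> carrier_vec ?n" "w \<in> carrier_vec ?n" "?f v = ?f w"
    \<comment> \<open>Writing the difference with the factor - 1 makes additivity and homogeneity of
      the parametrisation applicable.\<close>
    have vw': "v - w = v + (- 1) \<cdot>\<^sub>v w" using vw by (intro eq_vecI) auto
    have "?f (v - w) = ?f v + scale_edge_fun (- 1) (?f w)"
      unfolding vw' using vw by (simp only: edge_solution_add edge_solution_smult smult_carrier_vec)
    then have "?f (v - w) = 0" using vw(3) by simp
    then have "v - w = 0\<^sub>v ?n"
      using vw by (intro edge_solution_eq_0D[OF pos \<open>k \<noteq> 0\<close>]) auto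
    then have d: "vec_index (v - w) i = 0" if "i < ?n" for i using that by simp
    show "v = w"
    proof (rule eq_vecI)
      fix i assume "i < dim_vec w"
      then show "vec_index v i = vec_index w i" using d[of i] vw by simp
    qed (use vw in simp)
  qed
  \<comment> \<open>Gives both the finite spanning set demanded by
    \<open>has_geometric_multiplicity\<close> and the dimension formula.\<close>
  note dim = edge_fun.dim_image_mat_kernel[OF Z edge_solution_add edge_solution_smult inj]
  have nonzero: "?f v \<noteq> 0 \<longleftrightarrow> v \<noteq> 0\<^sub>v ?n" if "v \<in> mat_kernel ?Z" for v
    using edge_solution_eq_0D[OF pos \<open>k \<noteq> 0\<close> mat_kernelD(1)[OF Z that]] zero by blast
  \<comment> \<open>Since 0 lies in the kernel, a kernel other than {0} has a nonzero element; an
    empty set is excluded.\<close>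
  have "?Z *\<^sub>v 0\<^sub>v ?n = 0\<^sub>v ?n" using Z by (intro eq_vecI) auto
  then have Z0: "0\<^sub>v ?n \<in> mat_kernel ?Z" by (intro mat_kernelI[OF Z]) auto
  have "is_eigenvalue (graph_op_domain a\<^sub>d a\<^sub>t P L) (graph_op a\<^sub>d a\<^sub>t) (- k\<^sup>2) \<longleftrightarrow> (\<exists>u \<in> ?E. u \<noteq> 0)"
    by (auto simp only: is_eigenvalue_def eigenspace_def)
  also have "\<dots> \<longleftrightarrow> (\<exists>v \<in> mat_kernel ?Z. v \<noteq> 0\<^sub>v ?n)"
    unfolding E using nonzero by auto
  also have "\<dots> \<longleftrightarrow> mat_kernel ?Z \<noteq> {0\<^sub>v ?n}"
    using Z0 by auto
  finally show ?thesis
    unfolding has_geometric_multiplicity_def E using dim by blast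
qed

end
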